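(* Let $\mu \in \mathcal{M}_{\Psi}$ and $\rho \geq 0$. Consider the limit statements $$\text{(L)}\qquad \lim_{\tau\downarrow 0} \frac{\Psi_\mu(\tau \lambda)}{\Psi_\mu(\tau)} = \frac{1}{\lambda^\rho} \quad\text{for all } \lambda > 0,$$ $$\text{(F)}\qquad \lim_{t \uparrow \infty} \frac{F_\mu(tx)}{F_\mu(t)}=x^\rho \quad\text{for all } x > 0,$$ where (L) includes the assumption that $\Psi_\mu(\tau)\neq 0$ for all sufficiently small $\tau>0$, and (F) includes the assumption that $F_\mu(t)\ne 0$ for all sufficiently large $t$. (a) Suppose that $$\liminf_{\tau \downarrow 0}\frac{|\Psi_{\mu} (\tau )|}{\Psi_{|\mu|} (\tau ) } > 0$$ and that $$\limsup_{h \downarrow 0 }\limsup_{\tau \downarrow 0} \left| \frac{F_\mu(\tau^{-1}(x+h)) - F_\mu(\tau^{-1}x) }{ \Psi_{\mu}(\tau)}\right|=0 \quad\text{for all } x > 0.$$ Then (L) implies (F). (b) (F) implies (L). Moreover, in either case (that is, under the two displayed conditions of (a) together with (L), or under (F)), we have $$\Psi_\mu(t^{-1}) \sim F_\mu(t)\,\Gamma(\rho + 1) \quad \text{as } t \to \infty.$$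
   Context: $\mathbb{R}_+ := [0,\infty)$ with Borel $\sigma$-algebra $\mathscr{B}(\mathbb{R}_+)$. A positive Borel measure on $\mathbb{R}_+$ is a Radon measure if it is locally finite (every point has an open neighbourhood in $\mathbb{R}_+$ of finite measure) and inner regular (the measure of each Borel set is the supremum of the measures of its compact subsets). A mapping $\mu:\mathscr{B}(\mathbb{R}_+)\to\mathbb{R}\cup\{\infty\}$ is a generalised signed Radon measure if there exist mutually singular (positive) Radon measures $\mu^+$ and $\mu^-$ on $\mathbb{R}_+$ such that for each $A\in\mathscr{B}(\mathbb{R}_+)$, $\mu(A)=\mu^+(A)-\mu^-(A)$ if both $\mu^+(A),\mu^-(A)<\infty$, and $\mu(A)=+\infty$ otherwise. (Both $\mu^+$ and $\mu^-$ may have infinite total mass.) Set $|\mu|:=\mu^++\mu^-$. Integrals are $\int f\,\mathrm{d}\mu=\int f\,\mathrm{d}\mu^+-\int f\,\mathrm{d}\mu^-$ for $|\mu|$-integrable $f$. Let $\mathcal{M}^*$ be the space of all generalised signed Radon measures on $\mathbb{R}_+$. For $\mu\in\mathcal{M}^*$, the distribution function $F_\mu:\mathbb{R}_+\to\mathbb{R}$ is defined by $F_\mu(0):=0$ and $F_\mu(x):=\mu([0,x])$ for $x>0$. $\mathcal{M}_\Psi:=\{\mu\in\mathcal{M}^*:\int_{\mathbb{R}_+}e^{-\lambda x}\,|\mu|(\mathrm{d}x)<\infty\text{ for all }\lambda>0\}$. For $\mu\in\mathcal{M}_\Psi$, its Laplace transform is $\Psi_\mu(\lambda):=\int_{\mathbb{R}_+}e^{-\lambda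 x}\,\mu(\mathrm{d}x)$, $\lambda>0$; likewise $\Psi_{|\mu|}(\lambda)=\int_{\mathbb{R}_+}e^{-\lambda x}\,|\mu|(\mathrm{d}x)$. $\Gamma$ is the Gamma function, and $f(t)\sim g(t)$ as $t\to\infty$ means $f(t)/g(t)\to1$. *)

theory Defs
  imports "HOL-Analysis.Analysis"
begin

abbreviation borel_Rplus :: "real measure" where
  "borel_Rplus \<equiv> restrict_space borel {0..}"

definition radon_measure :: "real measure \<Rightarrow> bool" where
  "radon_measure M \<longleftrightarrow>
     sets M = sets borel_Rplus \<and>
     (\<forall>x\<in>{0..}. \<exists>U. openin (top_of_set {0..}) U \<and> x \<in> U \<and> emeasure M U < \<infinity>) \<and>
     (\<forall>A\<in>sets M. emeasure M A = (SUP K\<in>{K. compact K \<and> K \<subseteq> A}. emeasure M K))"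

definition mutually_singular :: "'a measure \<Rightarrow> 'a measure \<Rightarrow> bool" where
  "mutually_singular M N \<longleftrightarrow>
     sets M = sets N \<and>
     (\<exists>S\<in>sets M. emeasure M (space M - S) = 0 \<and> emeasure N S = 0)"

text \<open>A set function on the Borel sets of the half line is a function on all sets of reals
  of which only the values on \<^term>\<open>sets borel_Rplus\<close> are ever used.\<close>

definition is_decomposition ::
    "(real set \<Rightarrow> ereal) \<Rightarrow> real measure \<Rightarrow> real measure \<Rightarrow> bool" where
  "is_decomposition \<mu> P N \<longleftrightarrow>
     radon_measure P \<and> radon_measure N \<and> mutually_singular P N \<and>
     (\<forall>A\<in>sets borel_Rplus.
        \<mu> A = (if emeasure P A < \<infinity> \<and> emeasure N A < \<infinity>
               then enn2ereal (emeasure P A) - enn2ereal (emeasure N A) else \<infinity>))"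

definition gen_signed_radon :: "(real set \<Rightarrow> ereal) set" where
  "gen_signed_radon = {\<mu>. \<exists>P N. is_decomposition \<mu> P N}"

text \<open>The choice below is of a unique object, see \<open>pos_part_eq\<close> and \<open>neg_part_eq\<close>.\<close>

definition decomposition :: "(real set \<Rightarrow> ereal) \<Rightarrow> real measure \<times> real measure" where
  "decomposition \<mu> = (SOME (P, N). is_decomposition \<mu> P N)"

definition pos_part :: "(real set \<Rightarrow> ereal) \<Rightarrow> real measure" where
  "pos_part \<mu> = fst (decomposition \<mu>)"

definition neg_part :: "(real set \<Rightarrow> ereal) \<Rightarrow> real measure" where
  "neg_part \<mu> = snd (decomposition \<mu>)"

definition abs_measure :: "(real set \<Rightarrow> ereal) \<Rightarrow> real measure" where
  "abs_measure \<mu> = measure_of {0..} (sets borel_Rplus)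
     (\<lambda>A. emeasure (pos_part \<mu>) A + emeasure (neg_part \<mu>) A)"

definition signed_integral :: "(real set \<Rightarrow> ereal) \<Rightarrow> (real \<Rightarrow> real) \<Rightarrow> real" where
  "signed_integral \<mu> f = (\<integral>x. f x \<partial>pos_part \<mu>) - (\<integral>x. f x \<partial>neg_part \<mu>)"

definition distr_fun :: "(real set \<Rightarrow> ereal) \<Rightarrow> real \<Rightarrow> real" where
  "distr_fun \<mu> x = (if x = 0 then 0 else real_of_ereal (\<mu> {0..x}))"

definition laplace_domain :: "(real set \<Rightarrow> ereal) set" where
  "laplace_domain = {\<mu> \<in> gen_signed_radon.
     \<forall>s>0. (\<integral>\<^sup>+x. ennreal (exp (- s * x)) \<partial>abs_measure \<mu>) < \<infinity>}"

definition laplace :: "(real set \<Rightarrow> ereal) \<Rightarrow> real \<Rightarrow> real" where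
  "laplace \<mu> s = signed_integral \<mu> (\<lambda>x. exp (- s * x))"

definition laplace_abs :: "(real set \<Rightarrow> ereal) \<Rightarrow> real \<Rightarrow> real" where
  "laplace_abs \<mu> s = (\<integral>x. exp (- s * x) \<partial>abs_measure \<mu>)"

definition laplace_regularly_varying :: "(real set \<Rightarrow> ereal) \<Rightarrow> real \<Rightarrow> bool" where
  "laplace_regularly_varying \<mu> \<rho> \<longleftrightarrow>
     (\<forall>\<^sub>F \<tau> in at_right 0. laplace \<mu> \<tau> \<noteq> 0) \<and>
     (\<forall>s>0. ((\<lambda>\<tau>. laplace \<mu> (\<tau> * s) / laplace \<mu> \<tau>) \<longlongrightarrow> 1 / s powr \<rho>) (at_right 0))"

definition distr_regularly_varying :: "(real set \<Rightarrow> ereal) \<Rightarrow> real \<Rightarrow> bool" where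
  "distr_regularly_varying \<mu> \<rho> \<longleftrightarrow>
     (\<forall>\<^sub>F t in at_top. distr_fun \<mu> t \<noteq> 0) \<and>
     (\<forall>x>0. ((\<lambda>t. distr_fun \<mu> (t * x) / distr_fun \<mu> t) \<longlongrightarrow> x powr \<rho>) at_top)"

definition laplace_liminf_condition :: "(real set \<Rightarrow> ereal) \<Rightarrow> bool" where
  "laplace_liminf_condition \<mu> \<longleftrightarrow>
     Liminf (at_right 0) (\<lambda>\<tau>. ereal (\<bar>laplace \<mu> \<tau>\<bar> / laplace_abs \<mu> \<tau>)) > 0"

definition distr_increment_condition :: "(real set \<Rightarrow> ereal) \<Rightarrow> bool" where
  "distr_increment_condition \<mu> \<longleftrightarrow>
     (\<forall>x>0. Limsup (at_right 0) (\<lambda>h. Limsup (at_right 0) (\<lambda>\<tau>.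
        ereal \<bar>(distr_fun \<mu> (inverse \<tau> * (x + h)) - distr_fun \<mu> (inverse \<tau> * x))
                / laplace \<mu> \<tau>\<bar>)) = 0)"

lemma radon_measure_sets: "radon_measure M \<Longrightarrow> sets M = sets borel_Rplus"
  by (simp add: radon_measure_def)

lemma radon_measure_space: "radon_measure M \<Longrightarrow> space M = {0..}"
  using sets_eq_imp_space_eq[OF radon_measure_sets] by (simp add: space_restrict_space)

lemma interval_in_sets_borel_Rplus: "{0..a::real} \<in> sets borel_Rplus"
  by (auto simp: sets_restrict_space_iff)

lemma radon_measure_finite_interval:
  assumes "radon_measure M"
  shows "emeasure M {0..a} < \<infinity>"
proof -
  have "\<forall>x\<in>{0..a}. \<exists>T. open T \<and> x \<in> T \<and> emeasure M ({0..} \<inter> T) < \<infinity>"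
  proof
    fix x :: real assume "x \<in> {0..a}"
    then have "x \<in> {0..}" by simp
    then obtain U where "openin (top_of_set {0..}) U" "x \<in> U" "emeasure M U < \<infinity>"
      using assms unfolding radon_measure_def by blast
    then show "\<exists>T. open T \<and> x \<in> T \<and> emeasure M ({0..} \<inter> T) < \<infinity>"
      unfolding openin_open by blast
  qed
  then obtain T where T: "\<And>x. x \<in> {0..a} \<Longrightarrow> open (T x)" "\<And>x. x \<in> {0..a} \<Longrightarrow> x \<in> T x"
      "\<And>x. x \<in> {0..a} \<Longrightarrow> emeasure M ({0..} \<inter> T x) < \<infinity>"
    by metis
  have "{0..a} \<subseteq> (\<Union>x\<in>{0..a}. T x)" using T(2) by blast
  then obtain C where C: "C \<subseteq> {0..a}" "finite C" "{0..a} \<subseteq> (\<Union>x\<in>C. T x)"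
    using compactE_image[OF compact_Icc, of "{0..a}" T 0 a] T(1) by metis
  have s: "{0..} \<inter> T x \<in> sets M" if "x \<in> C" for x
    using T(1) C(1) that
    by (auto simp: radon_measure_sets[OF assms] sets_restrict_space_iff)
  have "emeasure M {0..a} \<le> emeasure M (\<Union>x\<in>C. {0..} \<inter> T x)"
  proof (rule emeasure_mono)
    show "{0..a} \<subseteq> (\<Union>x\<in>C. {0..} \<inter> T x)" using C(3) by force
    show "(\<Union>x\<in>C. {0..} \<inter> T x) \<in> sets M" using C(2) s by (intro sets.finite_UN) auto
  qed
  also have "\<dots> \<le> (\<Sum>x\<in>C. emeasure M ({0..} \<inter> T x))"
    using C(2) s by (intro emeasure_subadditive_finite) auto
  also have "\<dots> < \<infinity>"
    using C T(3) by (auto simp: less_top)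
  finally show ?thesis .
qed

lemma is_decomposition_le:
  assumes d: "is_decomposition \<mu> P N" and d': "is_decomposition \<mu> P' N'"
    and A: "A \<in> sets borel_Rplus"
  shows "emeasure P A \<le> emeasure P' A" "emeasure N A \<le> emeasure N' A"
proof -
  note r = d[unfolded is_decomposition_def] d'[unfolded is_decomposition_def]
  have rad: "radon_measure P" "radon_measure N" "radon_measure P'" "radon_measure N'"
    using r by auto
  have st: "sets P = sets borel_Rplus" "sets N = sets borel_Rplus"
      "sets P' = sets borel_Rplus" "sets N' = sets borel_Rplus"
    using rad by (auto simp: radon_measure_sets)
  obtain S where S: "S \<in> sets P" "emeasure P (space P - S) = 0" "emeasure N S = 0"
    using r unfolding mutually_singular_def by blast
  define I where "I n = A \<inter> {0..real n}" for n
  have I: "I n \<in> sets borel_Rplus" for n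
    unfolding I_def using A interval_in_sets_borel_Rplus by (rule sets.Int)
  have fin: "emeasure M B < \<infinity>" if "radon_measure M" "B \<subseteq> I n" for M B n
  proof -
    have "emeasure M B \<le> emeasure M {0..real n}"
      using that interval_in_sets_borel_Rplus[of "real n"]
      by (intro emeasure_mono) (auto simp: radon_measure_sets I_def)
    then show ?thesis using radon_measure_finite_interval[OF that(1)] le_less_trans by blast
  qed
  have eq: "enn2ereal (emeasure P B) - enn2ereal (emeasure N B) =
      enn2ereal (emeasure P' B) - enn2ereal (emeasure N' B)"
    if "B \<in> sets borel_Rplus" "B \<subseteq> I n" for B n
  proof -
    note f = rad[THEN fin, OF that(2)]
    have "\<mu> B = enn2ereal (emeasure P B) - enn2ereal (emeasure N B)"
      using r(1) that(1) f by simp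
    moreover have "\<mu> B = enn2ereal (emeasure P' B) - enn2ereal (emeasure N' B)"
      using r(2) that(1) f by simp
    ultimately show ?thesis by simp
  qed
  have eq_measure: "measure P B - measure N B = measure P' B - measure N' B"
    if "B \<in> sets borel_Rplus" "B \<subseteq> I n" for B n
  proof -
    have e: "enn2ereal (emeasure M B) = ereal (measure M B)" if "radon_measure M" for M
      using fin[OF that \<open>B \<subseteq> I n\<close>]
      by (subst emeasure_eq_ennreal_measure) (auto simp: enn2ereal_ennreal)
    show ?thesis using eq[OF that] rad by (simp add: e)
  qed
  have le: "emeasure P (I n) \<le> emeasure P' (I n)" "emeasure N (I n) \<le> emeasure N' (I n)" for n
  proof -
    have 1: "I n \<inter> S \<in> sets borel_Rplus" and 2: "I n - S \<in> sets borel_Rplus"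
      using I[of n] S(1) st by auto
    have mono: "emeasure M B \<le> emeasure M (I n)" if "sets M = sets borel_Rplus" "B \<subseteq> I n" for M B
      using that I by (intro emeasure_mono) auto
    have i: "I n \<subseteq> space P"
      using sets.sets_into_space[of "I n" P] I[of n] st(1) by simp
    have P0: "emeasure P (I n - S) = 0"
      by (rule emeasure_eq_0[of "space P - S"]) (use S i in auto)
    have N0: "emeasure N (I n \<inter> S) = 0"
      by (rule emeasure_eq_0[of S]) (use S st in auto)
    have cmp: "emeasure M B \<le> emeasure M' B"
      if "radon_measure M" "radon_measure M'" "B \<subseteq> I n" "measure M B \<le> measure M' B" for M M' B
      using fin[OF that(1,3)] fin[OF that(2,3)] that(4)
      by (simp add: emeasure_eq_ennreal_measure)
    have "emeasure P (I n) = emeasure P (I n \<inter> S) + emeasure P (I n - S)"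
      using 1 2 st by (subst plus_emeasure) (auto simp: Int_Diff_Un)
    also have "\<dots> = emeasure P (I n \<inter> S)" by (simp add: P0)
    also have "\<dots> \<le> emeasure P' (I n \<inter> S)"
    proof (rule cmp[OF rad(1,3)])
      show "measure P (I n \<inter> S) \<le> measure P' (I n \<inter> S)"
        using eq_measure[OF 1, of n] N0 by (simp add: measure_def)
    qed simp
    also have "\<dots> \<le> emeasure P' (I n)" by (rule mono[OF st(3)]) simp
    finally show "emeasure P (I n) \<le> emeasure P' (I n)" .
    have "emeasure N (I n) = emeasure N (I n \<inter> S) + emeasure N (I n - S)"
      using 1 2 st by (subst plus_emeasure) (auto simp: Int_Diff_Un)
    also have "\<dots> = emeasure N (I n - S)" by (simp add: N0)
    also have "\<dots> \<le> emeasure N' (I n - S)"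
    proof (rule cmp[OF rad(2,4)])
      have "measure P' (I n - S) \<ge> 0" "measure P (I n - S) = 0"
        using P0 by (simp_all add: measure_def)
      then show "measure N (I n - S) \<le> measure N' (I n - S)"
        using eq_measure[OF 2 Diff_subset] by linarith
    qed auto
    also have "\<dots> \<le> emeasure N' (I n)" by (rule mono[OF st(4)]) auto
    finally show "emeasure N (I n) \<le> emeasure N' (I n)" .
  qed
  have "A \<subseteq> {0..}" using A by (auto simp: sets_restrict_space_iff)
  then have U: "(\<Union>n. I n) = A"
    unfolding I_def by (auto intro: real_arch_simple)
  have inc: "incseq I" unfolding I_def by (auto simp: incseq_def)
  have sup: "emeasure M A = (SUP n. emeasure M (I n))" if "sets M = sets borel_Rplus" for M
  proof -
    have "range I \<subseteq> sets M" using I that by blast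
    from SUP_emeasure_incseq[OF this inc] show ?thesis by (simp add: U)
  qed
  show "emeasure P A \<le> emeasure P' A"
    unfolding sup[OF st(1)] sup[OF st(3)] by (intro SUP_mono') (rule le)
  show "emeasure N A \<le> emeasure N' A"
    unfolding sup[OF st(2)] sup[OF st(4)] by (intro SUP_mono') (rule le)
qed

lemma is_decomposition_unique:
  assumes "is_decomposition \<mu> P N" "is_decomposition \<mu> P' N'"
  shows "P = P'" "N = N'"
proof -
  have st: "sets P = sets borel_Rplus" "sets N = sets borel_Rplus"
      "sets P' = sets borel_Rplus" "sets N' = sets borel_Rplus"
    using assms by (auto simp: is_decomposition_def radon_measure_sets)
  show "P = P'"
    by (rule measure_eqI)
      (use st assms in \<open>auto intro!: antisym is_decomposition_le(1)[OF assms]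
        is_decomposition_le(1)[OF assms(2,1)]\<close>)
  show "N = N'"
    by (rule measure_eqI)
      (use st assms in \<open>auto intro!: antisym is_decomposition_le(2)[OF assms]
        is_decomposition_le(2)[OF assms(2,1)]\<close>)
qed

lemma is_decomposition_parts:
  assumes "\<mu> \<in> gen_signed_radon"
  shows "is_decomposition \<mu> (pos_part \<mu>) (neg_part \<mu>)"
proof -
  have "\<exists>x. (case x of (P, N) \<Rightarrow> is_decomposition \<mu> P N)"
    using assms by (auto simp: gen_signed_radon_def)
  from someI_ex[OF this]
  have "case decomposition \<mu> of (P, N) \<Rightarrow> is_decomposition \<mu> P N"
    unfolding decomposition_def .
  then show ?thesis
    by (simp add: pos_part_def neg_part_def case_prod_beta)
qed

lemma
  assumes "is_decomposition \<mu> P N"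
  shows pos_part_eq: "pos_part \<mu> = P" and neg_part_eq: "neg_part \<mu> = N"
proof -
  have "\<mu> \<in> gen_signed_radon" using assms by (auto simp: gen_signed_radon_def)
  from is_decomposition_unique[OF is_decomposition_parts[OF this] assms]
  show "pos_part \<mu> = P" "neg_part \<mu> = N" by auto
qed

lemma sets_abs_measure: "sets (abs_measure \<mu>) = sets borel_Rplus"
proof -
  have "space borel_Rplus = ({0..} :: real set)" by (simp add: space_restrict_space)
  then show ?thesis
    unfolding abs_measure_def using sets.sets_measure_of_eq[of borel_Rplus] by simp
qed

lemma emeasure_abs_measure:
  assumes "\<mu> \<in> gen_signed_radon" "A \<in> sets borel_Rplus"
  shows "emeasure (abs_measure \<mu>) A = emeasure (pos_part \<mu>) A + emeasure (neg_part \<mu>) A"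
proof -
  have sp: "space borel_Rplus = ({0..} :: real set)" by (simp add: space_restrict_space)
  have st: "sets (pos_part \<mu>) = sets borel_Rplus" "sets (neg_part \<mu>) = sets borel_Rplus"
    using is_decomposition_parts[OF assms(1)]
    by (auto simp: is_decomposition_def radon_measure_sets)
  show ?thesis
    unfolding abs_measure_def
  proof (rule emeasure_measure_of_sigma)
    show "sigma_algebra {0..} (sets borel_Rplus)"
      using sets.sigma_algebra_axioms[of borel_Rplus] by (simp add: sp)
    show "positive (sets borel_Rplus) (\<lambda>A. emeasure (pos_part \<mu>) A + emeasure (neg_part \<mu>) A)"
      by (simp add: positive_def)
    show "countably_additive (sets borel_Rplus)
        (\<lambda>A. emeasure (pos_part \<mu>) A + emeasure (neg_part \<mu>) A)"
    proof (rule countably_additiveI)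
      fix B :: "nat \<Rightarrow> real set"
      assume B: "range B \<subseteq> sets borel_Rplus" "disjoint_family B"
      show "(\<Sum>i. emeasure (pos_part \<mu>) (B i) + emeasure (neg_part \<mu>) (B i)) =
          emeasure (pos_part \<mu>) (\<Union>i. B i) + emeasure (neg_part \<mu>) (\<Union>i. B i)"
        using B st by (simp add: suminf_add[symmetric] suminf_emeasure)
    qed
  qed (rule assms)
qed

end

theory Submission
  imports Defs
begin

text \<open>
  Write \<open>F\<close> for the distribution function and \<open>\<Psi>\<close> for the Laplace transform. Integration by parts gives
  \<open>\<Psi>(s/t) = \<integral>\<^sub>0\<^sup>\<infinity> s exp(-s y) F(t y) dy\<close>, so everything can be phrased in terms of the functions
  \<open>y \<mapsto> F(t y)\<close>, without reference to signed measures.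

  Abelian direction: a regularly varying \<open>F\<close> satisfies the Potter-type bound
  \<open>|F(t y) / F(t)| \<le> C (y powr (-1/2) + y powr (\<rho> + 1/2))\<close>, and dominated convergence yields
  \<open>\<Psi>(1/t) / F(t) \<longlongrightarrow> \<Gamma>(\<rho> + 1)\<close>.

  Tauberian direction: put \<open>G\<^sub>t(y) = F(t y) / \<Psi>(1/t)\<close>. The liminf condition gives
  \<open>|G\<^sub>t(y)| \<le> C exp(y/2)\<close>, and the hypothesis on \<open>\<Psi>\<close> says that the moments of
  \<open>exp(-y) G\<^sub>t(y) dy\<close> in the variable \<open>exp(-y)\<close> converge, hence by Weierstrass the integrals of all
  continuous functions of \<open>exp(-y)\<close>. Testing with a bump supported just to the right of \<open>x\<close> gives
  convergence of local averages of \<open>G\<^sub>t\<close>, and the increment condition, which is only pointwise in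
  \<open>h\<close>, is integrated over the bump by dominated convergence to pass to \<open>G\<^sub>t(x)\<close> itself.
\<close>

section \<open>Integration by parts for Laplace transforms, and integrals of Gamma type\<close>

text \<open>The integral of \<open>s * exp (- s * y)\<close> over \<open>y \<ge> x / t\<close> is
  \<open>exp (- (s / t) * x)\<close>; exchanging the two integrals by Tonelli leaves the mass of the
  points \<open>x \<le> t * y\<close>. Stated for nonnegative integrals it presupposes no
  integrability, so it can also be used to compare two measures.\<close>

lemma nn_integral_laplace_by_parts:
  fixes M :: "real measure"
  assumes M: "sets M = sets borel_Rplus" and fin: "\<And>a. emeasure M {0..a} < \<infinity>"
    and s: "s > 0" and t: "t > 0"
  shows "(\<integral>\<^sup>+x. ennreal (exp (- (s / t) * x)) \<partial>M) =
    (\<integral>\<^sup>+y. ennreal (indicator {0<..} y * (s * exp (- s * y) * measure M {0..t * y})) \<partial>lborel)"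
proof -
  have sp: "space M = {0..}"
    using sets_eq_imp_space_eq[OF M] by (simp add: space_restrict_space)
  have I: "{0..a} \<in> sets M" for a :: real
    using interval_in_sets_borel_Rplus M by simp
  have sf: "sigma_finite_measure M"
  proof (rule sigma_finite_measure.intro, intro exI conjI)
    show "countable (range (\<lambda>n. {0..real n}))" by simp
    show "range (\<lambda>n. {0..real n}) \<subseteq> sets M" using I by auto
    show "\<Union> (range (\<lambda>n. {0..real n})) = space M" by (auto simp: sp intro: real_arch_simple)
    show "\<forall>a\<in>range (\<lambda>n. {0..real n}). emeasure M a \<noteq> \<infinity>" using fin by (auto simp: less_top)
  qed
  interpret pair_sigma_finite M lborel
    by (rule pair_sigma_finite.intro[OF sf sigma_finite_lborel])
  have id[measurable]: "(\<lambda>x. x) \<in> M \<rightarrow>\<^sub>M borel"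
    unfolding measurable_cong_sets[OF M refl] by (intro measurable_restrict_space1) simp
  have meas: "(\<lambda>(x, y). ennreal (s * exp (- s * y)) * indicator {x / t..} y)
      \<in> borel_measurable (M \<Otimes>\<^sub>M lborel)"
  proof -
    have [measurable]: "fst \<in> M \<Otimes>\<^sub>M (lborel :: real measure) \<rightarrow>\<^sub>M borel"
      using measurable_compose[OF measurable_fst id] by simp
    have "(\<lambda>(x, y). ennreal (s * exp (- s * y)) * indicator {x / t..} y) =
        (\<lambda>p. ennreal (s * exp (- s * snd p)) * (if fst p / t \<le> snd p then 1 else 0))"
      by (auto simp: fun_eq_iff indicator_def)
    also have "\<dots> \<in> borel_measurable (M \<Otimes>\<^sub>M lborel)" by measurable
    finally show ?thesis .
  qed
  have "(\<integral>\<^sup>+x. ennreal (exp (- (s / t) * x)) \<partial>M) =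
      (\<integral>\<^sup>+x. (\<integral>\<^sup>+y. ennreal (s * exp (- s * y)) * indicator {x / t..} y \<partial>lborel) \<partial>M)"
  proof (rule nn_integral_cong)
    fix x
    have "((\<lambda>y. - exp (- s * y)) \<longlongrightarrow> 0) at_top"
      using filterlim_compose[OF exp_at_bot
          filterlim_tendsto_neg_mult_at_bot[OF tendsto_const _ filterlim_ident], of "- s"] s
      by (auto intro: tendsto_eq_intros)
    then have "(\<integral>\<^sup>+y. ennreal (s * exp (- s * y)) * indicator {x / t..} y \<partial>lborel) =
        0 - (- exp (- s * (x / t)))"
      using s by (intro nn_integral_FTC_atLeast[where F="\<lambda>y. - exp (- s * y)"])
        (auto intro!: derivative_eq_intros)
    then show "ennreal (exp (- (s / t) * x)) =
      (\<integral>\<^sup>+y. ennreal (s * exp (- s * y)) * indicator {x / t..} y \<partial>lborel)" by simp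
  qed
  also have "\<dots> = (\<integral>\<^sup>+y. (\<integral>\<^sup>+x. ennreal (s * exp (- s * y)) * indicator {x / t..} y \<partial>M) \<partial>lborel)"
    by (rule Fubini'[OF meas, symmetric])
  also have "\<dots> = (\<integral>\<^sup>+y. ennreal (indicator {0<..} y * (s * exp (- s * y) * measure M {0..t * y})) \<partial>lborel)"
  \<comment> \<open>The integrands can differ at \<open>y = 0\<close> if \<open>M\<close> has an
    atom at 0, but a single point is a Lebesgue null set.\<close>
  proof (rule nn_integral_cong_AE)
    have "(\<integral>\<^sup>+x. ennreal (s * exp (- s * y)) * indicator {x / t..} y \<partial>M) =
        ennreal (indicator {0<..} y * (s * exp (- s * y) * measure M {0..t * y}))" if "y \<noteq> 0" for y
    proof -
      have "(\<integral>\<^sup>+x. ennreal (s * exp (- s * y)) * indicator {x / t..} y \<partial>M) =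
          (\<integral>\<^sup>+x. ennreal (s * exp (- s * y)) * indicator {0..t * y} x \<partial>M)"
        using t by (intro nn_integral_cong) (auto simp: sp indicator_def field_simps)
      also have "\<dots> = ennreal (s * exp (- s * y)) * emeasure M {0..t * y}"
        by (rule nn_integral_cmult_indicator) (rule I)
      also have "\<dots> = ennreal (s * exp (- s * y)) * ennreal (measure M {0..t * y})"
        using fin[of "t * y"] by (simp add: emeasure_eq_ennreal_measure less_top)
      also have "\<dots> = ennreal (indicator {0<..} y * (s * exp (- s * y) * measure M {0..t * y}))"
        using s t that by (auto simp: ennreal_mult' indicator_def mult_less_0_iff not_less)
      finally show ?thesis .
    qed
    then show "AE y in lborel. (\<integral>\<^sup>+x. ennreal (s * exp (- s * y)) * indicator {x / t..} y \<partial>M) =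
        ennreal (indicator {0<..} y * (s * exp (- s * y) * measure M {0..t * y}))"
      using AE_lborel_singleton[of "0::real"] by (auto elim: eventually_mono)
  qed
  finally show ?thesis .
qed

text \<open>Euler's integral for the Gamma function after replacing \<open>y\<close> by
  \<open>c * y\<close>. It evaluates the limits in both directions and makes the dominating
  functions integrable.\<close>

lemma has_bochner_integral_Gamma:
  fixes r c :: real
  assumes r: "r > -1" and c: "c > 0"
  shows "has_bochner_integral lborel (\<lambda>y. indicator {0<..} y * (exp (- c * y) * y powr r))
    (Gamma (r + 1) / c powr (r + 1))"
proof -
  let ?f = "\<lambda>y::real. indicator {0<..} y * (exp (- y) * y powr r)"
  have "has_bochner_integral lborel ?f (Gamma (r + 1))"
  proof (rule has_bochner_integral_nn_integral)
    show "?f \<in> borel_measurable lborel" by measurable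
    show "0 \<le> Gamma (r + 1)" using r by (simp add: Gamma_real_nonneg)
    show "(\<integral>\<^sup>+y. ennreal (?f y) \<partial>lborel) = ennreal (Gamma (r + 1))"
      using r by (subst Gamma_conv_nn_integral_real)
        (auto intro!: nn_integral_cong simp: indicator_def exp_minus field_simps)
  qed (auto intro!: AE_I2)
  then have "has_bochner_integral lborel (\<lambda>y. ?f (0 + c * y)) (Gamma (r + 1) /\<^sub>R \<bar>c\<bar>)"
    by (subst lborel_has_bochner_integral_real_affine_iff[symmetric]) (use c in auto)
  from has_bochner_integral_mult_right[OF this, of "1 / c powr r"]
  show ?thesis
  proof (rule has_bochner_integral_cong[OF refl _ _, THEN iffD1, rotated 2])
    show "1 / c powr r * ?f (0 + c * y) = indicator {0<..} y * (exp (- c * y) * y powr r)" for y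
      using c by (auto simp: indicator_def powr_mult zero_less_mult_iff)
  qed (use c in \<open>simp_all add: powr_add field_simps\<close>)
qed

lemma integrable_exp_halfline:
  fixes c :: real
  assumes "c > 0"
  shows "integrable lborel (\<lambda>y. indicator {0<..} y * exp (- c * y))"
proof -
  have "(\<lambda>y. indicator {0<..} y * (exp (- c * y) * y powr 0)) = (\<lambda>y. indicator {0<..} y * exp (- c * y))"
    by (auto simp: fun_eq_iff indicator_def)
  then show ?thesis
    using has_bochner_integral_Gamma[of 0 c] assms by (simp add: has_bochner_integral_iff)
qed

section \<open>Convergence of moments and pointwise Tauberian convergence\<close>

text \<open>By Weierstrass \<open>g\<close> is uniformly close to a polynomial, and integrals of
  polynomials in \<open>u\<close> are finite combinations of moments. The densities
  \<open>v t\<close> may change sign, so the approximation error is controlled by the common bound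
  \<open>B\<close> on their L1 norms.\<close>

lemma tendsto_integral_continuous_of_moments:
  fixes M :: "'a measure" and u w :: "'a \<Rightarrow> real" and v :: "'i \<Rightarrow> 'a \<Rightarrow> real"
  assumes u[measurable]: "u \<in> borel_measurable M" and u01: "\<And>x. x \<in> space M \<Longrightarrow> u x \<in> {0..1}"
    and v: "\<forall>\<^sub>F t in Fi. integrable M (v t)" "\<forall>\<^sub>F t in Fi. (\<integral>x. \<bar>v t x\<bar> \<partial>M) \<le> B"
    and w: "integrable M w"
    and mom: "\<And>k::nat. ((\<lambda>t. \<integral>x. u x ^ k * v t x \<partial>M) \<longlongrightarrow> (\<integral>x. u x ^ k * w x \<partial>M)) Fi"
    and g: "continuous_on {0..1} g"
  shows "((\<lambda>t. \<integral>x. g (u x) * v t x \<partial>M) \<longlongrightarrow> (\<integral>x. g (u x) * w x \<partial>M)) Fi"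
proof (rule tendstoI)
  fix e :: real assume e: "e > 0"
  \<comment> \<open>\<open>D\<close> bounds the two L1 norms together, so the two approximation
    errors add up to at most \<open>e / 2\<close>; the summand 1 makes it positive.\<close>
  define D where "D = \<bar>B\<bar> + (\<integral>x. \<bar>w x\<bar> \<partial>M) + 1"
  have W: "(\<integral>x. \<bar>w x\<bar> \<partial>M) \<ge> 0" by simp
  have D: "D > 0" unfolding D_def using W by linarith
  \<comment> \<open>Continuity holds on the unit interval only, so measurability is obtained on the
    restricted space in which \<open>u\<close> takes its values.\<close>
  have comp: "(\<lambda>x. f (u x)) \<in> borel_measurable M" if "continuous_on {0..1} f" for f :: "real \<Rightarrow> real"
    by (rule measurable_compose[OF measurable_restrict_space2 borel_measurable_continuous_on_restrict[OF that]])
      (use u01 in auto)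
  have int: "integrable M (\<lambda>x. f (u x) * h x)"
    if f: "continuous_on {0..1} f" and h: "integrable M h" for f h :: "_ \<Rightarrow> real"
  proof -
    obtain c where c: "\<And>x. x \<in> {0..1} \<Longrightarrow> norm (f x) \<le> c"
      using compact_imp_bounded[OF compact_continuous_image[OF f compact_Icc]]
      unfolding bounded_iff by blast
    have [measurable]: "h \<in> borel_measurable M" using h by simp
    note comp[OF f, measurable]
    show ?thesis
    proof (rule Bochner_Integration.integrable_bound)
      show "integrable M (\<lambda>x. c * h x)" using h by simp
      show "AE x in M. norm (f (u x) * h x) \<le> norm (c * h x)"
      proof (rule AE_I2)
        fix x assume "x \<in> space M"
        then have "\<bar>f (u x)\<bar> \<le> \<bar>c\<bar>" using c[OF u01] by force
        then show "norm (f (u x) * h x) \<le> norm (c * h x)"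
          by (simp add: abs_mult mult_right_mono)
      qed
    qed measurable
  qed
  obtain p where rp: "real_polynomial_function p"
    and p: "\<And>x. x \<in> {0..1} \<Longrightarrow> \<bar>g x - p x\<bar> < e / (2 * D)"
    using Stone_Weierstrass_real_polynomial_function[OF compact_Icc g, of "e / (2 * D)"] e D by auto
  obtain a n where pa: "p = (\<lambda>x. \<Sum>i\<le>n. a i * x ^ i)"
    using rp unfolding real_polynomial_function_iff_sum by blast
  have cp: "continuous_on {0..1} p" unfolding pa by (intro continuous_intros)
  have err: "\<bar>(\<integral>x. g (u x) * h x \<partial>M) - (\<integral>x. p (u x) * h x \<partial>M)\<bar> \<le> e / (2 * D) * (\<integral>x. \<bar>h x\<bar> \<partial>M)"
    if h: "integrable M h" for h
  proof -
    have "(\<integral>x. g (u x) * h x \<partial>M) - (\<integral>x. p (u x) * h x \<partial>M) =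
        (\<integral>x. g (u x) * h x - p (u x) * h x \<partial>M)"
      using int[OF g h] int[OF cp h] by simp
    also have "\<bar>\<dots>\<bar> \<le> (\<integral>x. e / (2 * D) * \<bar>h x\<bar> \<partial>M)"
    proof (rule order_trans[OF integral_abs_bound integral_mono])
      show "integrable M (\<lambda>x. \<bar>g (u x) * h x - p (u x) * h x\<bar>)"
        using int[OF g h] int[OF cp h] by simp
      show "integrable M (\<lambda>x. e / (2 * D) * \<bar>h x\<bar>)" using h by simp
      show "\<bar>g (u x) * h x - p (u x) * h x\<bar> \<le> e / (2 * D) * \<bar>h x\<bar>" if "x \<in> space M" for x
        using p[OF u01[OF that]]
        by (simp add: left_diff_distrib[symmetric] abs_mult mult_right_mono del: times_divide_eq_left)
    qed
    finally show ?thesis by simp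
  qed
  have sum: "(\<integral>x. p (u x) * h x \<partial>M) = (\<Sum>i\<le>n. a i * (\<integral>x. u x ^ i * h x \<partial>M))"
    if h: "integrable M h" for h
  proof -
    have "(\<integral>x. p (u x) * h x \<partial>M) = (\<integral>x. (\<Sum>i\<le>n. a i * (u x ^ i * h x)) \<partial>M)"
      by (simp add: pa sum_distrib_right mult.assoc)
    also have "\<dots> = (\<Sum>i\<le>n. \<integral>x. a i * (u x ^ i * h x) \<partial>M)"
      by (intro Bochner_Integration.integral_sum integrable_mult_right int[OF _ h]) (intro continuous_intros)
    finally show ?thesis by simp
  qed
  have "((\<lambda>t. \<Sum>i\<le>n. a i * (\<integral>x. u x ^ i * v t x \<partial>M)) \<longlongrightarrow>
      (\<Sum>i\<le>n. a i * (\<integral>x. u x ^ i * w x \<partial>M))) Fi"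
    by (intro tendsto_intros mom)
  from tendstoD[OF this, of "e / 2"]
  have "\<forall>\<^sub>F t in Fi. \<bar>(\<Sum>i\<le>n. a i * (\<integral>x. u x ^ i * v t x \<partial>M)) -
      (\<Sum>i\<le>n. a i * (\<integral>x. u x ^ i * w x \<partial>M))\<bar> < e / 2"
    using e by (simp add: dist_real_def)
  with v show "\<forall>\<^sub>F t in Fi. dist (\<integral>x. g (u x) * v t x \<partial>M) (\<integral>x. g (u x) * w x \<partial>M) < e"
  proof eventually_elim
    case (elim t)
    have "e / (2 * D) * (\<integral>x. \<bar>v t x\<bar> \<partial>M) + e / (2 * D) * (\<integral>x. \<bar>w x\<bar> \<partial>M) \<le> e / (2 * D) * D"
      unfolding distrib_left[symmetric] using e D elim(2) by (intro mult_left_mono) (auto simp: D_def)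
    also have "\<dots> = e / 2" using D by simp
    finally show ?case
      using err[OF elim(1)] err[OF w] elim(3) sum[OF elim(1)] sum[OF w]
      unfolding dist_real_def by linarith
  qed
qed

text \<open>With a bump \<open>k\<close> of mass \<open>K\<close> near \<open>x\<close>,
  \<open>K * G t x\<close> is compared with the integral of \<open>k * G t\<close>, that with the
  integral of \<open>k * H\<close>, and the latter with \<open>K * H x\<close>. Increments are
  controlled only for \<open>h > 0\<close>, so the bump lies to the right of
  \<open>x\<close>.\<close>

lemma tauberian_pointwise:
  fixes G :: "real \<Rightarrow> real \<Rightarrow> real" and H :: "real \<Rightarrow> real"
  assumes G[measurable]: "\<And>t. G t \<in> borel_measurable borel"
    and bound: "\<forall>\<^sub>F t in at_top. \<forall>y>0. \<bar>G t y\<bar> \<le> C * exp (y / 2)"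
    and H: "integrable lborel (\<lambda>y. indicator {0<..} y * (exp (- y) * H y))"
    and mom: "\<And>k::nat. ((\<lambda>t. \<integral>y. indicator {0<..} y * (exp (- (real k + 1) * y) * G t y) \<partial>lborel)
      \<longlongrightarrow> (\<integral>y. indicator {0<..} y * (exp (- (real k + 1) * y) * H y) \<partial>lborel)) at_top"
    and x: "x > 0" and cont: "isCont H x"
    and inc: "\<And>\<epsilon>. \<epsilon> > 0 \<Longrightarrow>
      \<exists>\<delta>>0. \<forall>h\<in>{0<..<\<delta>}. \<forall>\<^sub>F t in at_top. \<bar>G t (x + h) - G t x\<bar> < \<epsilon>"
  shows "((\<lambda>t. G t x) \<longlongrightarrow> H x) at_top"
proof (rule tendstoI)
  fix e :: real assume e: "e > 0"
  \<comment> \<open>Four errors of size \<open>\<epsilon> * K\<close> are collected at the end: two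
    from \<open>Gx\<close>, once \<open>D t\<close> is below \<open>\<epsilon> * K\<close>, one from
    \<open>lim\<close> and one from \<open>Hx\<close>.\<close>
  define \<epsilon> where "\<epsilon> = e / 4"
  have \<epsilon>: "\<epsilon> > 0" using e by (simp add: \<epsilon>_def)
  obtain d1 where d1: "d1 > 0" "\<And>h. 0 < h \<Longrightarrow> h < d1 \<Longrightarrow> \<forall>\<^sub>F t in at_top. \<bar>G t (x + h) - G t x\<bar> < \<epsilon>"
    using inc[OF \<epsilon>] by auto
  obtain d2 where d2: "d2 > 0" "\<And>y. dist y x < d2 \<Longrightarrow> dist (H y) (H x) < \<epsilon>"
    using cont \<epsilon> unfolding continuous_at_eps_delta by blast
  define \<delta> where "\<delta> = min d1 d2"
  have \<delta>: "\<delta> > 0" "\<delta> \<le> d1" "\<delta> \<le> d2" using d1 d2 by (auto simp: \<delta>_def)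
  \<comment> \<open>A product of two ramps: continuous in \<open>u\<close>, and for
    \<open>u = exp (- y)\<close> positive exactly when \<open>x < y < x + \<delta>\<close>.\<close>
  define g :: "real \<Rightarrow> real" where "g u = max 0 (exp (- x) - u) * max 0 (u - exp (- (x + \<delta>)))" for u
  have g01: "0 \<le> g u" "g u \<le> 1" if "0 \<le> u" "u \<le> 1" for u
  proof -
    have "exp (- x) \<le> 1" "exp (- (x + \<delta>)) \<ge> 0" using x by auto
    then have "max 0 (exp (- x) - u) \<le> 1" "max 0 (u - exp (- (x + \<delta>))) \<le> 1"
      using that by linarith+
    then show "0 \<le> g u" "g u \<le> 1" unfolding g_def by (auto intro!: mult_le_one)
  qed
  have g_zero: "g (exp (- y)) = 0" if "y \<notin> {x<..<x + \<delta>}" for y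
    using that by (auto simp: g_def max_def)
  have g_pos: "g (exp (- y)) > 0" if "y \<in> {x<..<x + \<delta>}" for y
    using that by (auto simp: g_def max_def)
  define k where "k y = indicator {0<..} y * (exp (- y) * g (exp (- y)))" for y :: real
  have [measurable]: "k \<in> borel_measurable borel" unfolding k_def g_def by measurable
  have k0: "k y \<ge> 0" for y using g01(1)[of "exp (- y)"] by (simp add: k_def indicator_def)
  have k0': "k y = 0" if "y \<notin> {x<..<x + \<delta>}" for y using g_zero[OF that] by (simp add: k_def)
  have kpos: "k y > 0" if "y \<in> {x<..<x + \<delta>}" for y using g_pos[OF that] that x by (simp add: k_def)
  have kle: "k y \<le> indicator {0<..} y * exp (- y)" for y
    using g01(2)[of "exp (- y)"] by (simp add: k_def indicator_def mult_left_le)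
  note ie = integrable_exp_halfline
  have kexp: "integrable lborel (\<lambda>y. k y * exp (y / 2))"
  proof (rule Bochner_Integration.integrable_bound[OF ie[of "1/2"]])
    show "AE y in lborel. norm (k y * exp (y / 2)) \<le> norm (indicator {0<..} y * exp (- (1/2) * y))"
    proof (rule AE_I2)
      fix y :: real
      have "k y * exp (y / 2) \<le> (indicator {0<..} y * exp (- y)) * exp (y / 2)"
        using kle by (intro mult_right_mono) auto
      also have "\<dots> = indicator {0<..} y * exp (- (1/2) * y)"
        by (simp add: exp_add[symmetric] mult.assoc)
      finally show "norm (k y * exp (y / 2)) \<le> norm (indicator {0<..} y * exp (- (1/2) * y))"
        using k0 by (simp add: abs_mult)
    qed
  qed auto
  have ki: "integrable lborel k"
  proof (rule Bochner_Integration.integrable_bound[OF ie[of 1]])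
    show "AE y in lborel. norm (k y) \<le> norm (indicator {0<..} y * exp (- 1 * y))"
      using kle k0 by (intro AE_I2) simp
  qed auto
  define K where "K = (\<integral>y. k y \<partial>lborel)"
  have K: "K > 0"
  proof -
    have "K \<noteq> 0"
    proof
      assume "K = 0"
      then have "AE y in lborel. k y = 0"
        unfolding K_def using integral_nonneg_eq_0_iff_AE[OF ki] k0 by auto
      then have "AE y in lborel. y \<notin> {x<..<x + \<delta>}"
        using kpos by (auto elim!: eventually_mono) (metis greaterThanLessThan_iff less_irrefl)
      moreover have "{y \<in> space lborel. \<not> y \<notin> {x<..<x + \<delta>}} = {x<..<x + \<delta>}" by auto
      ultimately have "emeasure lborel {x<..<x + \<delta>} = 0"
        by (subst (asm) AE_iff_measurable[of "{x<..<x + \<delta>}"]) auto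
      then show False using \<delta> by simp
    qed
    moreover have "K \<ge> 0" unfolding K_def using k0 by simp
    ultimately show ?thesis by simp
  qed
  have kH: "integrable lborel (\<lambda>y. k y * H y)"
  proof -
    have "integrable lborel (\<lambda>y. g (exp (- y)) * (indicator {0<..} y * (exp (- y) * H y)))"
    proof (rule Bochner_Integration.integrable_bound[OF H])
      have [measurable]: "(\<lambda>y. indicator {0<..} y * (exp (- y) * H y)) \<in> borel_measurable lborel"
        using H by simp
      show "(\<lambda>y. g (exp (- y)) * (indicator {0<..} y * (exp (- y) * H y))) \<in> borel_measurable lborel"
        unfolding g_def by measurable
      show "AE y in lborel. norm (g (exp (- y)) * (indicator {0<..} y * (exp (- y) * H y)))
          \<le> norm (indicator {0<..} y * (exp (- y) * H y))"
        using g01 by (intro AE_I2) (auto simp: abs_mult indicator_def intro!: mult_left_le_one_le)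
    qed
    then show ?thesis by (simp add: k_def mult_ac)
  qed
  have kG: "integrable lborel (\<lambda>y. k y * G t y)" if bd: "\<forall>y>0. \<bar>G t y\<bar> \<le> C * exp (y / 2)" for t
  proof (rule Bochner_Integration.integrable_bound)
    show "integrable lborel (\<lambda>y. C * (k y * exp (y / 2)))" using kexp by simp
    show "AE y in lborel. norm (k y * G t y) \<le> norm (C * (k y * exp (y / 2)))"
    proof (rule AE_I2)
      fix y :: real
      have "\<bar>G t y\<bar> \<le> \<bar>C\<bar> * exp (y / 2)" if "k y \<noteq> 0"
      proof -
        have "y > 0" using that k0'[of y] x by force
        then have "\<bar>G t y\<bar> \<le> C * exp (y / 2)" using bd by blast
        also have "\<dots> \<le> \<bar>C\<bar> * exp (y / 2)" by (intro mult_right_mono) auto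
        finally show ?thesis .
      qed
      then have "k y * \<bar>G t y\<bar> \<le> k y * (\<bar>C\<bar> * exp (y / 2))"
        using k0[of y] by (cases "k y = 0") (auto intro: mult_left_mono)
      then show "norm (k y * G t y) \<le> norm (C * (k y * exp (y / 2)))"
        using k0 by (simp add: abs_mult mult_ac)
    qed
  qed auto
  have lim: "((\<lambda>t. \<integral>y. k y * G t y \<partial>lborel) \<longlongrightarrow> (\<integral>y. k y * H y \<partial>lborel)) at_top"
  proof -
    \<comment> \<open>The maximum keeps \<open>u\<close> in the unit interval on the whole line;
      where the indicator is nonzero, \<open>u y\<close> is \<open>exp (- y)\<close>.\<close>
    define u where "u y = exp (- max 0 y)" for y :: real
    have pw: "u y ^ j * (indicator {0<..} y * (exp (- y) * f)) =
        indicator {0<..} y * (exp (- (real j + 1) * y) * f)" for y f j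
      by (auto simp: u_def indicator_def exp_of_nat_mult[symmetric] exp_add[symmetric] algebra_simps)
    have gw: "g (u y) * (indicator {0<..} y * (exp (- y) * f)) = k y * f" for y f
      by (auto simp: k_def u_def indicator_def)
    have iG: "integrable lborel (\<lambda>y. indicator {0<..} y * (exp (- y) * G t y))"
        "(\<integral>y. \<bar>indicator {0<..} y * (exp (- y) * G t y)\<bar> \<partial>lborel)
          \<le> (\<integral>y. C * (indicator {0<..} y * exp (- (1/2) * y)) \<partial>lborel)"
      if bd: "\<forall>y>0. \<bar>G t y\<bar> \<le> C * exp (y / 2)" for t
    proof -
      have le: "\<bar>indicator {0<..} y * (exp (- y) * G t y)\<bar> \<le> C * (indicator {0<..} y * exp (- (1/2) * y))"
        for y
      proof (cases "y > 0")
        case True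
        then have "exp (- y) * \<bar>G t y\<bar> \<le> exp (- y) * (C * exp (y / 2))"
          using bd by (intro mult_left_mono) auto
        also have "\<dots> = C * exp (- (1/2) * y)" by (simp add: exp_add[symmetric] mult_ac)
        finally show ?thesis using True by (simp add: abs_mult)
      qed simp
      have ib: "integrable lborel (\<lambda>y. C * (indicator {0<..} y * exp (- (1/2) * y)))"
        using ie[of "1/2"] by simp
      show i: "integrable lborel (\<lambda>y. indicator {0<..} y * (exp (- y) * G t y))"
      proof (rule Bochner_Integration.integrable_bound[OF ib])
        show "AE y in lborel. norm (indicator {0<..} y * (exp (- y) * G t y))
            \<le> norm (C * (indicator {0<..} y * exp (- (1/2) * y)))"
          unfolding real_norm_def by (intro AE_I2 order_trans[OF le abs_ge_self])
      qed measurable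
      show "(\<integral>y. \<bar>indicator {0<..} y * (exp (- y) * G t y)\<bar> \<partial>lborel)
          \<le> (\<integral>y. C * (indicator {0<..} y * exp (- (1/2) * y)) \<partial>lborel)"
        by (rule integral_mono[OF _ ib]) (use i le in auto)
    qed
    have "((\<lambda>t. \<integral>y. g (u y) * (indicator {0<..} y * (exp (- y) * G t y)) \<partial>lborel) \<longlongrightarrow>
        (\<integral>y. g (u y) * (indicator {0<..} y * (exp (- y) * H y)) \<partial>lborel)) at_top"
    proof (rule tendsto_integral_continuous_of_moments[where u=u and g=g])
      show "u \<in> borel_measurable lborel" unfolding u_def by measurable
      show "\<forall>\<^sub>F t in at_top. integrable lborel (\<lambda>y. indicator {0<..} y * (exp (- y) * G t y))"
        using bound by eventually_elim (rule iG(1))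
      show "\<forall>\<^sub>F t in at_top. (\<integral>y. \<bar>indicator {0<..} y * (exp (- y) * G t y)\<bar> \<partial>lborel)
          \<le> (\<integral>y. C * (indicator {0<..} y * exp (- (1/2) * y)) \<partial>lborel)"
        using bound by eventually_elim (rule iG(2))
      show "continuous_on {0..1} g" unfolding g_def by (intro continuous_intros)
    qed (use H mom in \<open>simp_all add: u_def[abs_def] pw[unfolded u_def]\<close>)
    then show ?thesis by (simp only: gw)
  qed
  \<comment> \<open>\<open>D t\<close> integrates the part of the oscillation that exceeds
    \<open>\<epsilon>\<close>. For each fixed \<open>y\<close> the integrand is eventually 0,
    without any uniformity in \<open>y\<close>; the growth bound then allows dominated
    convergence.\<close>
  define D where "D t = (\<integral>y. k y * max 0 (\<bar>G t y - G t x\<bar> - \<epsilon>) \<partial>lborel)" for t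
  have dom: "norm (k y * max 0 (\<bar>G t y - G t x\<bar> - \<epsilon>)) \<le> C * (k y * exp (y / 2)) + C * exp (x / 2) * k y"
    if bd: "\<forall>y>0. \<bar>G t y\<bar> \<le> C * exp (y / 2)" for t y
  proof (cases "k y = 0")
    case False
    then have "y > 0" using k0'[of y] x by force
    then have "\<bar>G t y\<bar> \<le> C * exp (y / 2)" "\<bar>G t x\<bar> \<le> C * exp (x / 2)" using bd x by auto
    then have "max 0 (\<bar>G t y - G t x\<bar> - \<epsilon>) \<le> C * exp (y / 2) + C * exp (x / 2)"
      using \<epsilon> by linarith
    then have "k y * max 0 (\<bar>G t y - G t x\<bar> - \<epsilon>) \<le> k y * (C * exp (y / 2) + C * exp (x / 2))"
      using k0 by (rule mult_left_mono)
    then show ?thesis using k0 by (simp add: abs_mult algebra_simps)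
  qed simp
  have idom: "integrable lborel (\<lambda>y. C * (k y * exp (y / 2)) + C * exp (x / 2) * k y)"
    using kexp ki by simp
  have D0: "(D \<longlongrightarrow> (\<integral>y. 0 \<partial>(lborel :: real measure))) at_top"
    unfolding D_def
  proof (rule integral_dominated_convergence_at_top[OF _ _ idom])
    show "\<forall>\<^sub>F t in at_top. AE y in lborel. norm (k y * max 0 (\<bar>G t y - G t x\<bar> - \<epsilon>))
        \<le> C * (k y * exp (y / 2)) + C * exp (x / 2) * k y"
      using bound by eventually_elim (intro AE_I2 dom)
    show "AE y in lborel. ((\<lambda>t. k y * max 0 (\<bar>G t y - G t x\<bar> - \<epsilon>)) \<longlongrightarrow> 0) at_top"
    proof (rule AE_I2)
      fix y :: real
      have "\<forall>\<^sub>F t in at_top. k y * max 0 (\<bar>G t y - G t x\<bar> - \<epsilon>) = 0"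
      proof (cases "y \<in> {x<..<x + \<delta>}")
        case True
        then have "\<forall>\<^sub>F t in at_top. \<bar>G t (x + (y - x)) - G t x\<bar> < \<epsilon>"
          using \<delta> by (intro d1(2)) auto
        then show ?thesis by eventually_elim (auto simp: max_def)
      qed (simp add: k0')
      then show "((\<lambda>t. k y * max 0 (\<bar>G t y - G t x\<bar> - \<epsilon>)) \<longlongrightarrow> 0) at_top"
        by (rule tendsto_eventually)
    qed
  qed measurable
  have Hx: "\<bar>K * H x - (\<integral>y. k y * H y \<partial>lborel)\<bar> \<le> \<epsilon> * K"
  proof -
    have "K * H x - (\<integral>y. k y * H y \<partial>lborel) = (\<integral>y. k y * H x - k y * H y \<partial>lborel)"
      using ki kH by (simp add: K_def)
    also have "\<bar>\<dots>\<bar> \<le> (\<integral>y. \<epsilon> * k y \<partial>lborel)"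
    proof (rule order_trans[OF integral_abs_bound integral_mono])
      show "\<bar>k y * H x - k y * H y\<bar> \<le> \<epsilon> * k y" for y
      proof (cases "y \<in> {x<..<x + \<delta>}")
        case True
        then have "dist (H y) (H x) < \<epsilon>" using \<delta> by (intro d2(2)) (auto simp: dist_real_def)
        then have "k y * \<bar>H x - H y\<bar> \<le> k y * \<epsilon>"
          using k0 by (intro mult_left_mono) (auto simp: dist_real_def)
        moreover have "k y * H x - k y * H y = k y * (H x - H y)" by (simp add: algebra_simps)
        ultimately show ?thesis using k0[of y] by (simp add: abs_mult mult.commute[of _ \<epsilon>])
      qed (simp add: k0')
    qed (use ki kH in auto)
    finally show ?thesis by (simp add: K_def)
  qed
  have Gx: "\<bar>K * G t x - (\<integral>y. k y * G t y \<partial>lborel)\<bar> \<le> \<epsilon> * K + D t"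
    if bd: "\<forall>y>0. \<bar>G t y\<bar> \<le> C * exp (y / 2)" for t
  proof -
    have iD: "integrable lborel (\<lambda>y. k y * max 0 (\<bar>G t y - G t x\<bar> - \<epsilon>))"
    proof (rule Bochner_Integration.integrable_bound[OF idom])
      show "AE y in lborel. norm (k y * max 0 (\<bar>G t y - G t x\<bar> - \<epsilon>))
          \<le> norm (C * (k y * exp (y / 2)) + C * exp (x / 2) * k y)"
        unfolding real_norm_def[of "_ + _"] by (intro AE_I2 order_trans[OF dom[OF bd] abs_ge_self])
    qed measurable
    have "K * G t x - (\<integral>y. k y * G t y \<partial>lborel) = (\<integral>y. k y * G t x - k y * G t y \<partial>lborel)"
      using ki kG[OF bd] by (simp add: K_def)
    also have "\<bar>\<dots>\<bar> \<le> (\<integral>y. \<epsilon> * k y + k y * max 0 (\<bar>G t y - G t x\<bar> - \<epsilon>) \<partial>lborel)"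
    proof (rule order_trans[OF integral_abs_bound integral_mono])
      show "\<bar>k y * G t x - k y * G t y\<bar> \<le> \<epsilon> * k y + k y * max 0 (\<bar>G t y - G t x\<bar> - \<epsilon>)" for y
      proof -
        have "k y * \<bar>G t x - G t y\<bar> \<le> k y * (\<epsilon> + max 0 (\<bar>G t y - G t x\<bar> - \<epsilon>))"
          using k0 by (intro mult_left_mono) linarith+
        moreover have "k y * G t x - k y * G t y = k y * (G t x - G t y)" by (simp add: algebra_simps)
        ultimately show ?thesis using k0[of y] by (simp add: abs_mult distrib_left mult.commute[of _ \<epsilon>])
      qed
    qed (use ki kG[OF bd] iD in auto)
    also have "\<dots> = \<epsilon> * K + D t" using ki iD by (simp add: K_def D_def)
    finally show ?thesis .
  qed
  have "\<forall>\<^sub>F t in at_top. \<bar>D t\<bar> < \<epsilon> * K"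
    using D0 K \<epsilon> unfolding tendsto_iff dist_real_def by auto
  moreover have "\<forall>\<^sub>F t in at_top. \<bar>(\<integral>y. k y * G t y \<partial>lborel) - (\<integral>y. k y * H y \<partial>lborel)\<bar> < \<epsilon> * K"
    using lim K \<epsilon> unfolding tendsto_iff dist_real_def by auto
  ultimately show "\<forall>\<^sub>F t in at_top. dist (G t x) (H x) < e"
    using bound
  proof eventually_elim
    case (elim t)
    have "\<bar>K * G t x - K * H x\<bar> < 4 * (\<epsilon> * K)"
      using elim(1,2) Gx[OF elim(3)] Hx by linarith
    also have "\<dots> = K * e" by (simp add: \<epsilon>_def)
    also have "\<bar>K * G t x - K * H x\<bar> = K * \<bar>G t x - H x\<bar>"
      using K by (simp add: right_diff_distrib[symmetric] abs_mult)
    finally show ?case using K by (simp add: dist_real_def)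
  qed
qed

section \<open>Uniformity in slow variation and Potter-type bounds\<close>

text \<open>Comparing both \<open>k u\<close> and \<open>k (u + d)\<close> with \<open>k (u + d + s)\<close> and averaging over \<open>s\<close> bounds the increment
  by integrals that tend to 0 by dominated convergence and no longer involve \<open>d\<close> separately;
  truncation at \<open>\<epsilon>\<close> supplies the dominating function.\<close>

lemma slowly_varying_uniform:
  fixes k :: "real \<Rightarrow> real"
  assumes k[measurable]: "k \<in> borel_measurable borel"
    and lim: "\<And>s. s \<ge> 0 \<Longrightarrow> ((\<lambda>u. k (u + s) - k u) \<longlongrightarrow> 0) at_top" and \<epsilon>: "\<epsilon> > 0"
  obtains U where "\<And>u d. u \<ge> U \<Longrightarrow> 0 \<le> d \<Longrightarrow> d \<le> 1 \<Longrightarrow> \<bar>k (u + d) - k u\<bar> \<le> \<epsilon>"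
proof -
  \<comment> \<open>The window of length 3 contains both \<open>{0..2}\<close> and
    \<open>{d..d + 2}\<close> for every \<open>d\<close> between 0 and 1.\<close>
  define I where "I u = (\<integral>s. indicator {0..3} s * min \<epsilon> \<bar>k (u + s) - k u\<bar> \<partial>lborel)" for u
  have bdd: "integrable lborel (\<lambda>s. indicator {a..b} s * min \<epsilon> \<bar>f s\<bar>)"
    if [measurable]: "f \<in> borel_measurable borel" for f :: "real \<Rightarrow> real" and a b
  proof (rule Bochner_Integration.integrable_bound)
    show "integrable lborel (\<lambda>s. indicator {a..b} s * \<epsilon>)"
      by (intro integrable_mult_left integrable_real_indicator) (auto simp: emeasure_lborel_Icc_eq)
    show "AE s in lborel. norm (indicator {a..b} s * min \<epsilon> \<bar>f s\<bar>) \<le> norm (indicator {a..b} s * \<epsilon>)"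
      using \<epsilon> by (intro AE_I2) (auto simp: indicator_def)
  qed measurable
  have "(I \<longlongrightarrow> (\<integral>s. 0 \<partial>(lborel :: real measure))) at_top"
    unfolding I_def
  proof (rule integral_dominated_convergence_at_top[where w="\<lambda>s. indicator {0..3} s * \<epsilon>"])
    show "\<forall>\<^sub>F u in at_top. AE s in lborel. norm (indicator {0..3} s * min \<epsilon> \<bar>k (u + s) - k u\<bar>)
        \<le> indicator {0..3} s * \<epsilon>"
      using \<epsilon> by (intro always_eventually allI AE_I2) (auto simp: indicator_def)
    show "AE s in lborel. ((\<lambda>u. indicator {0..3} s * min \<epsilon> \<bar>k (u + s) - k u\<bar>) \<longlongrightarrow> 0) at_top"
    proof (rule AE_I2)
      fix s :: real
      show "((\<lambda>u. indicator {0..3} s * min \<epsilon> \<bar>k (u + s) - k u\<bar>) \<longlongrightarrow> 0) at_top"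
      proof (cases "s \<in> {0..3}")
        case True
        then have "((\<lambda>u. min \<epsilon> \<bar>k (u + s) - k u\<bar>) \<longlongrightarrow> min \<epsilon> \<bar>0\<bar>) at_top"
          by (intro tendsto_intros lim) auto
        then show ?thesis using \<epsilon> True by simp
      qed simp
    qed
  qed auto
  from tendstoD[OF this, of "\<epsilon> / 2"] have "\<forall>\<^sub>F u in at_top. \<bar>I u\<bar> < \<epsilon> / 2"
    using \<epsilon> by (simp add: dist_real_def)
  then obtain U where U: "\<And>u. u \<ge> U \<Longrightarrow> \<bar>I u\<bar> < \<epsilon> / 2"
    unfolding eventually_at_top_linorder by blast
  have "\<bar>k (u + d) - k u\<bar> \<le> \<epsilon>" if u: "u \<ge> U" and d: "0 \<le> d" "d \<le> 1" for u d
  proof -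
    let ?m = "min \<epsilon> \<bar>k (u + d) - k u\<bar>"
    let ?f1 = "\<lambda>s. indicator {0..2} s * min \<epsilon> \<bar>k (u + d + s) - k (u + d)\<bar>"
    let ?f2 = "\<lambda>s. indicator {0..2} s * min \<epsilon> \<bar>k (u + d + s) - k u\<bar>"
    have i: "integrable lborel ?f1" "integrable lborel ?f2" by (intro bdd; measurable)+
    have "2 * ?m = (\<integral>s. indicator {0..2::real} s * ?m \<partial>lborel)" by simp
    also have "\<dots> \<le> (\<integral>s. ?f1 s + ?f2 s \<partial>lborel)"
    proof (rule integral_mono)
      show "indicator {0..2} s * ?m \<le> ?f1 s + ?f2 s" for s
        using \<epsilon> by (auto simp: indicator_def min_def)
    qed (use i in auto)
    also have "\<dots> = (\<integral>s. ?f1 s \<partial>lborel) + (\<integral>s. ?f2 s \<partial>lborel)" using i by simp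
    also have "(\<integral>s. ?f1 s \<partial>lborel) \<le> I (u + d)"
      unfolding I_def by (intro integral_mono bdd i) (use \<epsilon> in \<open>auto simp: indicator_def\<close>)
    also have "(\<integral>s. ?f2 s \<partial>lborel) = (\<integral>s. indicator {d..d + 2} s * min \<epsilon> \<bar>k (u + s) - k u\<bar> \<partial>lborel)"
      by (subst (2) lborel_integral_real_affine[where c=1 and t=d])
        (auto simp: indicator_def add.assoc intro!: Bochner_Integration.integral_cong)
    also have "\<dots> \<le> I u"
      unfolding I_def by (intro integral_mono bdd) (use \<epsilon> d in \<open>auto simp: indicator_def\<close>)
    finally have "2 * ?m \<le> I (u + d) + I u" by simp
    also have "\<dots> < \<epsilon>" using U[of u] U[of "u + d"] u d by linarith
    \<comment> \<open>Here \<open>?m < \<epsilon>\<close>, so the truncation is inactive and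
      \<open>?m\<close> is the increment itself.\<close>
    finally show ?thesis using \<epsilon> by linarith
  qed
  then show thesis by (rule that)
qed

text \<open>The distance \<open>v\<close> is covered by as many steps of length at most 1 as the
  ceiling of \<open>v\<close>, which is at most \<open>v + 1\<close>, and each step costs at most
  \<open>\<epsilon>\<close>.\<close>

lemma increment_le_of_unit_increment_le:
  fixes k :: "real \<Rightarrow> real"
  assumes step: "\<And>u d. u \<ge> U \<Longrightarrow> 0 \<le> d \<Longrightarrow> d \<le> 1 \<Longrightarrow> \<bar>k (u + d) - k u\<bar> \<le> \<epsilon>"
    and u: "u \<ge> U" and v: "v \<ge> 0"
  shows "\<bar>k (u + v) - k u\<bar> \<le> \<epsilon> * (v + 1)"
proof -
  have \<epsilon>: "\<epsilon> \<ge> 0" using step[OF order_refl, of 0] by simp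
  have "\<bar>k (u + v) - k u\<bar> \<le> \<epsilon> * real n" if "0 \<le> v" "v \<le> real n" "u \<ge> U" for n u v
    using that
  proof (induction n arbitrary: v)
    case (Suc n)
    show ?case
    proof (cases "v \<le> 1")
      case True
      then have "\<bar>k (u + v) - k u\<bar> \<le> \<epsilon>" using step Suc.prems by auto
      also have "\<dots> \<le> \<epsilon> * real (Suc n)" using \<epsilon> by (simp add: algebra_simps)
      finally show ?thesis .
    next
      case False
      have "\<bar>k (u + (v - 1)) - k u\<bar> \<le> \<epsilon> * real n" using False Suc.prems by (intro Suc.IH) auto
      moreover have "\<bar>k (u + (v - 1) + 1) - k (u + (v - 1))\<bar> \<le> \<epsilon>"
        using False Suc.prems by (intro step) auto
      ultimately show ?thesis by (simp add: algebra_simps)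
    qed
  qed simp
  from this[of v "nat \<lceil>v\<rceil>" u] have "\<bar>k (u + v) - k u\<bar> \<le> \<epsilon> * real (nat \<lceil>v\<rceil>)"
    using u v by (simp add: real_nat_ceiling_ge)
  also have "\<dots> \<le> \<epsilon> * (v + 1)" using \<epsilon> v by (intro mult_left_mono) linarith+
  finally show ?thesis .
qed

text \<open>In logarithmic coordinates the increments of \<open>k\<close> tend to 0, hence grow at
  most linearly with slope 1/2; exponentiating turns this into a factor \<open>y powr (1/2)\<close>
  for \<open>y \<ge> 1\<close>. Both resulting exponents \<open>-1/2\<close> and
  \<open>\<rho> + 1/2\<close> exceed -1, so the bound stays integrable near 0.\<close>

lemma regularly_varying_bound:
  fixes F :: "real \<Rightarrow> real"
  assumes F[measurable]: "F \<in> borel_measurable borel" and \<rho>: "\<rho> \<ge> 0"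
    and bdd: "\<And>T. \<exists>M. \<forall>y. 0 < y \<and> y \<le> T \<longrightarrow> \<bar>F y\<bar> \<le> M"
    and nz: "\<forall>\<^sub>F t in at_top. F t \<noteq> 0"
    and lim: "\<And>x. x > 0 \<Longrightarrow> ((\<lambda>t. F (t * x) / F t) \<longlongrightarrow> x powr \<rho>) at_top"
  shows "\<exists>C T. \<forall>t\<ge>T. \<forall>y>0. \<bar>F (t * y) / F t\<bar> \<le> C * (y powr (-1/2) + y powr (\<rho> + 1/2))"
proof -
  define k where "k u = ln \<bar>F (exp u)\<bar> - \<rho> * u" for u
  have [measurable]: "k \<in> borel_measurable borel" unfolding k_def by measurable
  have klim: "((\<lambda>u. k (u + s) - k u) \<longlongrightarrow> 0) at_top" for s
  proof -
    have "((\<lambda>u. F (exp u * exp s) / F (exp u)) \<longlongrightarrow> exp s powr \<rho>) at_top"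
      by (rule filterlim_compose[OF lim exp_at_top]) simp
    then have "((\<lambda>u. ln \<bar>F (exp u * exp s) / F (exp u)\<bar> - \<rho> * s) \<longlongrightarrow>
        ln \<bar>exp s powr \<rho>\<bar> - \<rho> * s) at_top"
      by (intro tendsto_intros) auto
    then have l: "((\<lambda>u. ln \<bar>F (exp u * exp s) / F (exp u)\<bar> - \<rho> * s) \<longlongrightarrow> 0) at_top"
      by (simp add: powr_def mult.commute)
    have nz': "\<forall>\<^sub>F u in at_top. F (exp u) \<noteq> 0"
      using exp_at_top nz unfolding filterlim_iff by blast
    have nz'': "\<forall>\<^sub>F u in at_top. F (exp (u + s)) \<noteq> 0"
      using filterlim_compose[OF exp_at_top filterlim_tendsto_add_at_top[OF tendsto_const filterlim_ident], of s]
        nz unfolding filterlim_iff by (auto simp: add.commute)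
    show ?thesis
    proof (rule Lim_transform_eventually[OF l])
      show "\<forall>\<^sub>F u in at_top. ln \<bar>F (exp u * exp s) / F (exp u)\<bar> - \<rho> * s = k (u + s) - k u"
        using nz' nz'' by eventually_elim
          (simp add: k_def exp_add ln_div abs_divide algebra_simps)
    qed
  qed
  obtain U0 where U0: "\<And>u d. u \<ge> U0 \<Longrightarrow> 0 \<le> d \<Longrightarrow> d \<le> 1 \<Longrightarrow> \<bar>k (u + d) - k u\<bar> \<le> 1/2"
    using slowly_varying_uniform[of k "1/2"] klim by auto
  obtain N where N: "\<And>t. t \<ge> N \<Longrightarrow> F t \<noteq> 0" using nz unfolding eventually_at_top_linorder by blast
  define T where "T = max (exp U0) N"
  have T: "T > 0" "\<And>t. t \<ge> T \<Longrightarrow> F t \<noteq> 0" using N by (auto simp: T_def less_max_iff_disj)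
  have inc: "abs (ln (abs (F (a * y))) - ln (abs (F a)) - \<rho> * ln y) \<le> 1/2 * (ln y + 1)" if "a \<ge> T" "y \<ge> 1" for a y
  proof -
    have a: "a > 0" "a \<ge> exp U0" using that T by (auto simp: T_def)
    then have "ln a \<ge> U0" by (subst ln_ge_iff) auto
    from increment_le_of_unit_increment_le[OF U0 this, of "ln y"]
    have "\<bar>k (ln a + ln y) - k (ln a)\<bar> \<le> 1/2 * (ln y + 1)" using that by simp
    moreover have "exp (ln a + ln y) = a * y" using a that by (simp add: exp_add)
    ultimately show ?thesis using a by (simp add: k_def algebra_simps)
  qed
  \<comment> \<open>\<open>up\<close> moves from \<open>a\<close> to the larger point
    \<open>a * y\<close>. \<open>down\<close> moves back and drops the factor
    \<open>y powr (- \<rho>)\<close>, which is at most 1 for \<open>y \<ge> 1\<close>.\<close>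
  have up: "\<bar>F (a * y)\<bar> \<le> exp (1/2) * y powr (\<rho> + 1/2) * \<bar>F a\<bar>"
    and down: "\<bar>F a\<bar> \<le> exp (1/2) * y powr (1/2) * \<bar>F (a * y)\<bar>" if ay: "a \<ge> T" "y \<ge> 1" for a y
  proof -
    have "a * y \<ge> a * 1" using ay T by (intro mult_left_mono) auto
    then have nz: "F (a * y) \<noteq> 0" "F a \<noteq> 0" using T(2) ay by auto
    have ln: "ln y \<ge> 0" using ay by simp
    have "\<bar>F (a * y)\<bar> = exp (ln \<bar>F (a * y)\<bar>)" using nz by simp
    also have "\<dots> \<le> exp (1/2 + (\<rho> + 1/2) * ln y + ln \<bar>F a\<bar>)"
      using abs_le_D1[OF inc[OF ay]] by (simp add: algebra_simps)
    also have "\<dots> = exp (1/2) * y powr (\<rho> + 1/2) * \<bar>F a\<bar>"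
      using nz ay by (simp add: exp_add powr_def)
    finally show "\<bar>F (a * y)\<bar> \<le> exp (1/2) * y powr (\<rho> + 1/2) * \<bar>F a\<bar>" .
    have "\<bar>F a\<bar> = exp (ln \<bar>F a\<bar>)" using nz by simp
    also have "\<dots> \<le> exp (1/2 + 1/2 * ln y + ln \<bar>F (a * y)\<bar>)"
      using abs_le_D2[OF inc[OF ay]] mult_nonneg_nonneg[OF \<rho> ln] by (simp add: algebra_simps)
    also have "\<dots> = exp (1/2) * y powr (1/2) * \<bar>F (a * y)\<bar>"
      using nz ay by (simp add: exp_add powr_def)
    finally show "\<bar>F a\<bar> \<le> exp (1/2) * y powr (1/2) * \<bar>F (a * y)\<bar>" .
  qed
  obtain M where M: "\<And>y. 0 < y \<Longrightarrow> y \<le> T \<Longrightarrow> \<bar>F y\<bar> \<le> M" using bdd[of T] by blast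
  have FT: "\<bar>F T\<bar> > 0" using T(2) by simp
  have M0: "M \<ge> 0" using M[of T] T by linarith
  \<comment> \<open>The summand 1 serves the two ranges with \<open>t * y \<ge> T\<close>; the
    summand with \<open>M\<close> serves \<open>t * y < T\<close>, where only boundedness of
    \<open>F\<close> is known.\<close>
  define C where "C = exp (1/2) * (1 + M / \<bar>F T\<bar>)"
  have C: "exp (1/2) \<le> C" "exp (1/2) * (M / \<bar>F T\<bar>) \<le> C" using M0 FT by (auto simp: C_def field_simps)
  have C0: "C \<ge> 0" using C(1) order_trans[OF exp_ge_zero] by blast
  show ?thesis
  proof (intro exI allI impI)
    fix t y :: real assume t: "t \<ge> T" and y: "y > 0"
    have Ft: "\<bar>F t\<bar> > 0" using T(2)[OF t] by simp
    have t0: "t > 0" using t T by simp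
    have "\<bar>F (t * y)\<bar> \<le> C * (y powr (-1/2) + y powr (\<rho> + 1/2)) * \<bar>F t\<bar>"
    proof (cases "y \<ge> 1")
      case True
      have "\<bar>F (t * y)\<bar> \<le> exp (1/2) * y powr (\<rho> + 1/2) * \<bar>F t\<bar>" by (rule up[OF t True])
      also have "\<dots> \<le> C * (y powr (-1/2) + y powr (\<rho> + 1/2)) * \<bar>F t\<bar>"
        using C C0 by (intro mult_right_mono mult_mono) auto
      finally show ?thesis .
    next
      case False
      have "\<bar>F (t * y)\<bar> \<le> C * y powr (-1/2) * \<bar>F t\<bar>"
      proof (cases "t * y \<ge> T")
        case True
        \<comment> \<open>\<open>down\<close> with base point \<open>t * y\<close> and ratio
          \<open>1 / y > 1\<close> leads back to \<open>t\<close>.\<close>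
        have "\<bar>F (t * y)\<bar> \<le> exp (1/2) * (1 / y) powr (1/2) * \<bar>F (t * y * (1 / y))\<bar>"
          by (rule down[OF True]) (use y False in auto)
        also have "\<dots> = exp (1/2) * y powr (-1/2) * \<bar>F t\<bar>"
          using y by (simp add: powr_minus powr_divide field_simps)
        also have "\<dots> \<le> C * y powr (-1/2) * \<bar>F t\<bar>"
          using C C0 by (intro mult_right_mono mult_mono) auto
        finally show ?thesis .
      next
        case ty: False
        \<comment> \<open>The bound \<open>M\<close> is expressed through \<open>F T\<close>, which
          \<open>down\<close> compares with \<open>F t\<close>; then
          \<open>t / T \<le> 1 / y\<close> because \<open>t * y < T\<close>.\<close>
        have "\<bar>F (t * y)\<bar> \<le> M / \<bar>F T\<bar> * \<bar>F T\<bar>" using M[of "t * y"] ty t0 y FT by simp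
        also have "\<dots> \<le> M / \<bar>F T\<bar> * (exp (1/2) * y powr (-1/2) * \<bar>F t\<bar>)"
        proof (rule mult_left_mono)
          have "\<bar>F T\<bar> \<le> exp (1/2) * (t / T) powr (1/2) * \<bar>F (T * (t / T))\<bar>"
            by (rule down) (use t T in auto)
          also have "T * (t / T) = t" using T by simp
          also have "exp (1/2) * (t / T) powr (1/2) * \<bar>F t\<bar> \<le> exp (1/2) * (1 / y) powr (1/2) * \<bar>F t\<bar>"
            using ty T y t0 by (intro mult_right_mono mult_left_mono powr_mono2) (auto simp: field_simps)
          also have "(1 / y) powr (1/2) = y powr (-1/2)"
            using y by (simp add: powr_minus powr_divide field_simps)
          finally show "\<bar>F T\<bar> \<le> exp (1/2) * y powr (-1/2) * \<bar>F t\<bar>" .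
        qed (use M0 in simp)
        also have "\<dots> = exp (1/2) * (M / \<bar>F T\<bar>) * y powr (-1/2) * \<bar>F t\<bar>" by simp
        also have "\<dots> \<le> C * y powr (-1/2) * \<bar>F t\<bar>"
          using C C0 by (intro mult_right_mono) auto
        finally show ?thesis .
      qed
      also have "\<dots> \<le> C * (y powr (-1/2) + y powr (\<rho> + 1/2)) * \<bar>F t\<bar>"
        using C0 by (intro mult_right_mono mult_left_mono) auto
      finally show ?thesis .
    qed
    then show "\<bar>F (t * y) / F t\<bar> \<le> C * (y powr (-1/2) + y powr (\<rho> + 1/2))"
      using Ft by (simp add: abs_divide pos_divide_le_eq)
  qed
qed

lemma abelian_tendsto_Gamma:
  fixes F :: "real \<Rightarrow> real"
  assumes F[measurable]: "F \<in> borel_measurable borel" and \<rho>: "\<rho> \<ge> 0"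
    and bdd: "\<And>T. \<exists>M. \<forall>y. 0 < y \<and> y \<le> T \<longrightarrow> \<bar>F y\<bar> \<le> M"
    and nz: "\<forall>\<^sub>F t in at_top. F t \<noteq> 0"
    and lim: "\<And>x. x > 0 \<Longrightarrow> ((\<lambda>t. F (t * x) / F t) \<longlongrightarrow> x powr \<rho>) at_top"
  shows "((\<lambda>t. (\<integral>y. indicator {0<..} y * (exp (- y) * F (t * y)) \<partial>lborel) / F t) \<longlongrightarrow> Gamma (\<rho> + 1)) at_top"
proof -
  obtain C T where T: "\<And>t y. t \<ge> T \<Longrightarrow> y > 0 \<Longrightarrow>
      \<bar>F (t * y) / F t\<bar> \<le> C * (y powr (-1/2) + y powr (\<rho> + 1/2))"
    using regularly_varying_bound[OF F \<rho> bdd nz lim] by blast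
  \<comment> \<open>The dominating function is a combination of two integrands of Gamma type;
    \<open>- 1 * y\<close> matches \<open>has_bochner_integral_Gamma\<close> with
    \<open>c = 1\<close>.\<close>
  let ?w = "\<lambda>y. C * (indicator {0<..} y * (exp (- 1 * y) * y powr (-1/2)) +
      indicator {0<..} y * (exp (- 1 * y) * y powr (\<rho> + 1/2)))"
  have "((\<lambda>t. \<integral>y. indicator {0<..} y * (exp (- y) * (F (t * y) / F t)) \<partial>lborel) \<longlongrightarrow>
      (\<integral>y. indicator {0<..} y * (exp (- 1 * y) * y powr \<rho>) \<partial>lborel)) at_top"
  proof (rule integral_dominated_convergence_at_top[where w="?w"])
    show "integrable lborel ?w"
      using has_bochner_integral_Gamma[of "-1/2" 1] has_bochner_integral_Gamma[of "\<rho> + 1/2" 1] \<rho>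
      by (intro integrable_mult_right Bochner_Integration.integrable_add)
        (auto simp: has_bochner_integral_iff)
    show "\<forall>\<^sub>F t in at_top. AE y in lborel. norm (indicator {0<..} y * (exp (- y) * (F (t * y) / F t))) \<le> ?w y"
      using eventually_ge_at_top[of T]
    proof eventually_elim
      case (elim t)
      show ?case
      proof (rule AE_I2)
        fix y :: real
        show "norm (indicator {0<..} y * (exp (- y) * (F (t * y) / F t))) \<le> ?w y"
        proof (cases "y > 0")
          case True
          have "exp (- y) * \<bar>F (t * y) / F t\<bar> \<le> exp (- y) * (C * (y powr (-1/2) + y powr (\<rho> + 1/2)))"
            by (intro mult_left_mono T[OF elim True]) simp
          then show ?thesis using True by (simp add: abs_mult abs_divide algebra_simps)
        qed simp
      qed
    qed
    show "AE y in lborel. ((\<lambda>t. indicator {0<..} y * (exp (- y) * (F (t * y) / F t))) \<longlongrightarrow>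
        indicator {0<..} y * (exp (- 1 * y) * y powr \<rho>)) at_top"
    proof (rule AE_I2)
      fix y :: real
      show "((\<lambda>t. indicator {0<..} y * (exp (- y) * (F (t * y) / F t))) \<longlongrightarrow>
          indicator {0<..} y * (exp (- 1 * y) * y powr \<rho>)) at_top"
      proof (cases "y > 0")
        case True
        from tendsto_mult[OF tendsto_const lim[OF True], of "exp (- y)"] True
        show ?thesis by simp
      qed simp
    qed
  qed measurable
  also have "(\<integral>y. indicator {0<..} y * (exp (- 1 * y) * y powr \<rho>) \<partial>lborel) = Gamma (\<rho> + 1)"
    using has_bochner_integral_integral_eq[OF has_bochner_integral_Gamma[of \<rho> 1]] \<rho> by simp
  finally show ?thesis by simp
qed

section \<open>Distribution functions and Laplace transforms of generalised signed measures\<close>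

text \<open>Radon measures are finite on bounded intervals, so the value \<open>\<infinity>\<close>
  in the definition of a generalised signed measure does not arise here.\<close>

lemma distr_fun_eq:
  assumes "\<mu> \<in> gen_signed_radon"
  shows "distr_fun \<mu> y =
    (if y = 0 then 0 else measure (pos_part \<mu>) {0..y} - measure (neg_part \<mu>) {0..y})"
proof -
  have d: "is_decomposition \<mu> (pos_part \<mu>) (neg_part \<mu>)"
    by (rule is_decomposition_parts[OF assms])
  then have r: "radon_measure (pos_part \<mu>)" "radon_measure (neg_part \<mu>)"
    by (auto simp: is_decomposition_def)
  have f: "emeasure (pos_part \<mu>) {0..y} < \<infinity>" "emeasure (neg_part \<mu>) {0..y} < \<infinity>"
    using r[THEN radon_measure_finite_interval] by auto
  have "\<mu> {0..y} = enn2ereal (emeasure (pos_part \<mu>) {0..y}) - enn2ereal (emeasure (neg_part \<mu>) {0..y})"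
    using d f interval_in_sets_borel_Rplus[of y] by (simp add: is_decomposition_def)
  then show ?thesis
    using f by (simp add: distr_fun_def emeasure_eq_ennreal_measure less_top enn2ereal_ennreal)
qed

lemma mono_measure_interval:
  fixes M :: "real measure"
  assumes "sets M = sets borel_Rplus" "\<And>a. emeasure M {0..a} < \<infinity>"
  shows "mono (\<lambda>y. measure M {0..y})"
  using assms interval_in_sets_borel_Rplus
  by (intro monoI measure_mono_fmeasurable) (auto simp: fmeasurable_def)

lemma has_bochner_integral_laplace_by_parts:
  fixes M :: "real measure"
  assumes M: "sets M = sets borel_Rplus" "\<And>a. emeasure M {0..a} < \<infinity>"
    and s: "s > 0" and t: "t > 0" and fin: "(\<integral>\<^sup>+x. ennreal (exp (- (s / t) * x)) \<partial>M) < \<infinity>"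
  shows "integrable M (\<lambda>x. exp (- (s / t) * x))"
    and "has_bochner_integral lborel (\<lambda>y. indicator {0<..} y * (s * exp (- s * y) * measure M {0..t * y}))
      (\<integral>x. exp (- (s / t) * x) \<partial>M)"
proof -
  have [measurable]: "(\<lambda>y. measure M {0..y}) \<in> borel_measurable borel"
    by (intro borel_measurable_mono mono_measure_interval M)
  have "(\<lambda>x. exp (- (s / t) * x)) \<in> borel_measurable M"
    unfolding measurable_cong_sets[OF M(1) refl] by (intro measurable_restrict_space1) measurable
  then show i: "integrable M (\<lambda>x. exp (- (s / t) * x))"
    using fin by (intro integrableI_nonneg) auto
  show "has_bochner_integral lborel (\<lambda>y. indicator {0<..} y * (s * exp (- s * y) * measure M {0..t * y}))
      (\<integral>x. exp (- (s / t) * x) \<partial>M)"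
  proof (rule has_bochner_integral_nn_integral)
    show "(\<integral>\<^sup>+y. ennreal (indicator {0<..} y * (s * exp (- s * y) * measure M {0..t * y})) \<partial>lborel) =
        ennreal (\<integral>x. exp (- (s / t) * x) \<partial>M)"
      unfolding nn_integral_laplace_by_parts[OF M s t, symmetric]
      by (rule nn_integral_eq_integral[OF i]) simp
  qed (use s in \<open>auto simp: indicator_def\<close>)
qed

text \<open>The distribution function of \<open>abs_measure \<mu>\<close>, except that at 0 it keeps
  the mass of the atom there instead of being set to 0. It is a monotone majorant of the absolute
  value of \<open>distr_fun \<mu>\<close>.\<close>

definition variation_fun :: "(real set \<Rightarrow> ereal) \<Rightarrow> real \<Rightarrow> real" where
  "variation_fun \<mu> y = measure (pos_part \<mu>) {0..y} + measure (neg_part \<mu>) {0..y}"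

context
  fixes \<mu> :: "real set \<Rightarrow> ereal"
  assumes \<mu>: "\<mu> \<in> laplace_domain"
begin

lemma laplace_domain_gen: "\<mu> \<in> gen_signed_radon"
  using \<mu> by (simp add: laplace_domain_def)

lemma
  shows sets_pos_part: "sets (pos_part \<mu>) = sets borel_Rplus"
    and sets_neg_part: "sets (neg_part \<mu>) = sets borel_Rplus"
    and pos_part_finite: "emeasure (pos_part \<mu>) {0..a} < \<infinity>"
    and neg_part_finite: "emeasure (neg_part \<mu>) {0..a} < \<infinity>"
proof -
  have r: "radon_measure (pos_part \<mu>)" "radon_measure (neg_part \<mu>)"
    using is_decomposition_parts[OF laplace_domain_gen] by (auto simp: is_decomposition_def)
  show "sets (pos_part \<mu>) = sets borel_Rplus" "sets (neg_part \<mu>) = sets borel_Rplus"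
    using r by (auto simp: radon_measure_sets)
  show "emeasure (pos_part \<mu>) {0..a} < \<infinity>" "emeasure (neg_part \<mu>) {0..a} < \<infinity>"
    using r[THEN radon_measure_finite_interval] by auto
qed

lemma abs_measure_finite: "emeasure (abs_measure \<mu>) {0..a} < \<infinity>"
  using pos_part_finite[of a] neg_part_finite[of a]
  by (simp add: emeasure_abs_measure[OF laplace_domain_gen interval_in_sets_borel_Rplus])

lemma measure_abs_measure: "measure (abs_measure \<mu>) {0..a} = variation_fun \<mu> a"
  using pos_part_finite[of a] neg_part_finite[of a]
  by (simp add: measure_def variation_fun_def enn2real_plus
      emeasure_abs_measure[OF laplace_domain_gen interval_in_sets_borel_Rplus])

lemma abs_distr_fun_le: "\<bar>distr_fun \<mu> y\<bar> \<le> variation_fun \<mu> y"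
  unfolding distr_fun_eq[OF laplace_domain_gen] variation_fun_def
  by (auto intro!: order_trans[OF abs_triangle_ineq4])

lemma borel_measurable_parts [measurable]:
  "(\<lambda>y. measure (pos_part \<mu>) {0..y}) \<in> borel_measurable borel"
  "(\<lambda>y. measure (neg_part \<mu>) {0..y}) \<in> borel_measurable borel"
  by (intro borel_measurable_mono mono_measure_interval sets_pos_part sets_neg_part
    pos_part_finite neg_part_finite)+

lemma mono_variation_fun: "mono (variation_fun \<mu>)"
  using mono_measure_interval[OF sets_pos_part pos_part_finite] mono_measure_interval[OF sets_neg_part neg_part_finite]
  by (auto simp: mono_def variation_fun_def intro: add_mono)

lemma borel_measurable_distr_fun [measurable]: "distr_fun \<mu> \<in> borel_measurable borel"
  unfolding distr_fun_eq[OF laplace_domain_gen, abs_def] by measurable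

lemma nn_integral_abs_measure_finite:
  assumes "s > 0"
  shows "(\<integral>\<^sup>+x. ennreal (exp (- s * x)) \<partial>abs_measure \<mu>) < \<infinity>"
  using \<mu> assms by (simp add: laplace_domain_def)

lemma laplace_abs_by_parts:
  assumes s: "s > 0" and t: "t > 0"
  shows "integrable (abs_measure \<mu>) (\<lambda>x. exp (- (s / t) * x))"
    and "has_bochner_integral lborel (\<lambda>y. indicator {0<..} y * (s * exp (- s * y) * variation_fun \<mu> (t * y)))
      (laplace_abs \<mu> (s / t))"
  using has_bochner_integral_laplace_by_parts[OF sets_abs_measure abs_measure_finite s t
      nn_integral_abs_measure_finite] s t
  by (auto simp: measure_abs_measure laplace_abs_def)

text \<open>The formula for positive measures is subtracted for the two parts. On the domain of
  integration \<open>t * y > 0\<close>, so the convention \<open>distr_fun \<mu> 0 = 0\<close> does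
  not enter.\<close>

lemma laplace_by_parts:
  assumes s: "s > 0" and t: "t > 0"
  shows "has_bochner_integral lborel (\<lambda>y. indicator {0<..} y * (s * exp (- s * y) * distr_fun \<mu> (t * y)))
      (laplace \<mu> (s / t))"
proof -
  \<comment> \<open>Each part is compared with \<open>abs_measure \<mu>\<close> after integration by
    parts, where only masses of intervals matter.\<close>
  have fin: "(\<integral>\<^sup>+x. ennreal (exp (- (s / t) * x)) \<partial>M) < \<infinity>"
    if M: "sets M = sets borel_Rplus" "\<And>a. emeasure M {0..a} < \<infinity>"
      and le: "\<And>a. measure M {0..a} \<le> variation_fun \<mu> a" for M
  proof -
    have "(\<integral>\<^sup>+x. ennreal (exp (- (s / t) * x)) \<partial>M) \<le> (\<integral>\<^sup>+x. ennreal (exp (- (s / t) * x)) \<partial>abs_measure \<mu>)"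
      unfolding nn_integral_laplace_by_parts[OF M s t]
        nn_integral_laplace_by_parts[OF sets_abs_measure abs_measure_finite s t] measure_abs_measure
      using s le by (intro nn_integral_mono ennreal_leI mult_left_mono) auto
    also have "\<dots> < \<infinity>" by (rule nn_integral_abs_measure_finite) (use s t in simp)
    finally show ?thesis .
  qed
  have "has_bochner_integral lborel
      (\<lambda>y. indicator {0<..} y * (s * exp (- s * y) * measure (pos_part \<mu>) {0..t * y}) -
        indicator {0<..} y * (s * exp (- s * y) * measure (neg_part \<mu>) {0..t * y}))
      (laplace \<mu> (s / t))"
    unfolding laplace_def signed_integral_def
    by (intro has_bochner_integral_diff has_bochner_integral_laplace_by_parts s t fin
        sets_pos_part sets_neg_part pos_part_finite neg_part_finite)
      (auto simp: variation_fun_def)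
  moreover have "(\<lambda>y. indicator {0<..} y * (s * exp (- s * y) * measure (pos_part \<mu>) {0..t * y}) -
        indicator {0<..} y * (s * exp (- s * y) * measure (neg_part \<mu>) {0..t * y})) =
      (\<lambda>y. indicator {0<..} y * (s * exp (- s * y) * distr_fun \<mu> (t * y)))"
    using t by (auto simp: fun_eq_iff distr_fun_eq[OF laplace_domain_gen] indicator_def algebra_simps)
  ultimately show ?thesis by simp
qed

text \<open>A Chernoff-type bound: on \<open>{0..t * y}\<close> the integrand
  \<open>exp (- (s / t) * x)\<close> is at least \<open>exp (- (s * y))\<close>.\<close>

lemma variation_fun_le_laplace_abs:
  assumes t: "t > 0" and s: "s > 0"
  shows "variation_fun \<mu> (t * y) \<le> exp (s * y) * laplace_abs \<mu> (s / t)"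
proof -
  have I: "{0..t * y} \<in> sets (abs_measure \<mu>)"
    by (simp add: sets_abs_measure interval_in_sets_borel_Rplus)
  have "exp (- (s * y)) * variation_fun \<mu> (t * y) =
      (\<integral>x. exp (- (s * y)) * indicator {0..t * y} x \<partial>abs_measure \<mu>)"
    using I sets.sets_into_space[OF I] by (simp add: measure_abs_measure Int_absorb2)
  also have "\<dots> \<le> (\<integral>x. exp (- (s / t) * x) \<partial>abs_measure \<mu>)"
  proof (rule integral_mono)
    show "integrable (abs_measure \<mu>) (\<lambda>x. exp (- (s * y)) * indicator {0..t * y} x)"
      using I abs_measure_finite by (intro integrable_mult_right integrable_real_indicator) auto
    show "integrable (abs_measure \<mu>) (\<lambda>x. exp (- (s / t) * x))"
      by (rule laplace_abs_by_parts[OF s t])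
    show "exp (- (s * y)) * indicator {0..t * y} x \<le> exp (- (s / t) * x)" for x
      using s t by (auto simp: indicator_def field_simps)
  qed
  finally have "exp (s * y) * (exp (- (s * y)) * variation_fun \<mu> (t * y)) \<le> exp (s * y) * laplace_abs \<mu> (s / t)"
    unfolding laplace_abs_def by (rule mult_left_mono) simp
  then show ?thesis by (simp add: mult.assoc[symmetric] exp_add[symmetric])
qed

lemma laplace_asymp_of_distr:
  assumes \<rho>: "\<rho> \<ge> 0" and F: "distr_regularly_varying \<mu> \<rho>"
  shows "((\<lambda>t. laplace \<mu> (inverse t) / distr_fun \<mu> t) \<longlongrightarrow> Gamma (\<rho> + 1)) at_top"
proof -
  have "((\<lambda>t. (\<integral>y. indicator {0<..} y * (exp (- y) * distr_fun \<mu> (t * y)) \<partial>lborel) / distr_fun \<mu> t)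
      \<longlongrightarrow> Gamma (\<rho> + 1)) at_top"
  proof (rule abelian_tendsto_Gamma[OF borel_measurable_distr_fun \<rho>])
    show "\<exists>M. \<forall>y. 0 < y \<and> y \<le> T \<longrightarrow> \<bar>distr_fun \<mu> y\<bar> \<le> M" for T
      using abs_distr_fun_le monoD[OF mono_variation_fun] by (meson order_trans)
  qed (use F in \<open>auto simp: distr_regularly_varying_def\<close>)
  then show ?thesis
  proof (rule Lim_transform_eventually)
    show "\<forall>\<^sub>F t in at_top. (\<integral>y. indicator {0<..} y * (exp (- y) * distr_fun \<mu> (t * y)) \<partial>lborel) / distr_fun \<mu> t
        = laplace \<mu> (inverse t) / distr_fun \<mu> t"
      using eventually_gt_at_top[of 0]
    proof eventually_elim
      case (elim t)
      show ?case
        using has_bochner_integral_integral_eq[OF laplace_by_parts[OF zero_less_one elim]]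
        by (simp add: inverse_eq_divide)
    qed
  qed
qed

text \<open>The quotient is formed with \<open>laplace\<close> because the nonvanishing of
  \<open>distr_fun\<close> at large arguments is itself a consequence. The limit function is
  recognised by its Laplace transform \<open>1 / s powr (\<rho> + 1)\<close> at the integers
  \<open>s = k + 1\<close>.\<close>

lemma distr_asymp_of_laplace:
  assumes \<rho>: "\<rho> \<ge> 0" and L: "laplace_regularly_varying \<mu> \<rho>"
    and A: "laplace_liminf_condition \<mu>" and B: "distr_increment_condition \<mu>" and x: "x > 0"
  shows "((\<lambda>t. distr_fun \<mu> (t * x) / laplace \<mu> (inverse t)) \<longlongrightarrow> x powr \<rho> / Gamma (\<rho> + 1)) at_top"
proof -
  have Gpos: "Gamma (\<rho> + 1) > 0" using \<rho> by (simp add: Gamma_real_pos)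
  have nz: "\<forall>\<^sub>F t in at_top. laplace \<mu> (inverse t) \<noteq> 0"
    using L by (simp add: laplace_regularly_varying_def eventually_at_right_to_top)
  have lim: "((\<lambda>t. laplace \<mu> (s / t) / laplace \<mu> (inverse t)) \<longlongrightarrow> 1 / s powr \<rho>) at_top" if "s > 0" for s
    using L that
    by (simp add: laplace_regularly_varying_def filterlim_at_right_to_top divide_inverse mult.commute)
  obtain c where c: "c > 0" "\<forall>\<^sub>F \<tau> in at_right 0. ereal c < ereal (\<bar>laplace \<mu> \<tau>\<bar> / laplace_abs \<mu> \<tau>)"
  proof -
    obtain z where z: "0 < ereal z" "ereal z < Liminf (at_right 0) (\<lambda>\<tau>. ereal (\<bar>laplace \<mu> \<tau>\<bar> / laplace_abs \<mu> \<tau>))"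
      using ereal_dense2[of 0] A unfolding laplace_liminf_condition_def by blast
    then show thesis using that[of z] less_LiminfD[OF z(2)] by simp
  qed
  have nonneg: "laplace_abs \<mu> \<tau> \<ge> 0" for \<tau> by (simp add: laplace_abs_def)
  \<comment> \<open>The argument \<open>(1/2) / t\<close> comes from
    \<open>variation_fun_le_laplace_abs\<close> with \<open>s = 1/2\<close>, whose growth
    \<open>exp (y / 2)\<close> is slower than the decay of the weight
    \<open>exp (- y)\<close>.\<close>
  have half: "\<forall>\<^sub>F t in at_top. laplace_abs \<mu> ((1/2) / t) \<le> \<bar>laplace \<mu> ((1/2) / t)\<bar> / c"
  proof -
    have "\<forall>\<^sub>F t in at_top. c < \<bar>laplace \<mu> (inverse t)\<bar> / laplace_abs \<mu> (inverse t)"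
      using c(2) by (simp add: eventually_at_right_to_top)
    moreover have "filterlim (\<lambda>t::real. 2 * t) at_top at_top"
      by (rule filterlim_tendsto_pos_mult_at_top[OF tendsto_const _ filterlim_ident]) simp
    ultimately have "\<forall>\<^sub>F t in at_top. c < \<bar>laplace \<mu> (inverse (2 * t))\<bar> / laplace_abs \<mu> (inverse (2 * t))"
      unfolding filterlim_iff by blast
    then show ?thesis
    proof eventually_elim
      case (elim t)
      \<comment> \<open>Division by 0 yields 0, so a quotient above \<open>c > 0\<close> has a
        nonzero denominator.\<close>
      have "laplace_abs \<mu> (inverse (2 * t)) \<noteq> 0" using elim c(1) by auto
      then have "laplace_abs \<mu> (inverse (2 * t)) > 0" using nonneg[of "inverse (2 * t)"] by simp
      then show ?case using elim c(1) by (simp add: field_simps)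
    qed
  qed
  show ?thesis
  proof (rule tauberian_pointwise[where G="\<lambda>t y. distr_fun \<mu> (t * y) / laplace \<mu> (inverse t)"
        and H="\<lambda>y. y powr \<rho> / Gamma (\<rho> + 1)" and C="(1 / (1/2) powr \<rho> + 1) / c"])
    show "(\<lambda>y. distr_fun \<mu> (t * y) / laplace \<mu> (inverse t)) \<in> borel_measurable borel" for t
      by measurable
    \<comment> \<open>The hypothesis on \<open>laplace\<close> at the ratio 1/2 leads from the
      argument \<open>(1/2) / t\<close> back to \<open>inverse t\<close>.\<close>
    have "\<forall>\<^sub>F t in at_top. \<bar>laplace \<mu> ((1/2) / t) / laplace \<mu> (inverse t)\<bar> < 1 / (1/2) powr \<rho> + 1"
    proof -
      have "((\<lambda>t. \<bar>laplace \<mu> ((1/2) / t) / laplace \<mu> (inverse t)\<bar>) \<longlongrightarrow> \<bar>1 / (1/2) powr \<rho>\<bar>) at_top"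
        by (intro tendsto_rabs lim) simp
      then show ?thesis by (rule order_tendstoD) simp
    qed
    then show "\<forall>\<^sub>F t in at_top. \<forall>y>0. \<bar>distr_fun \<mu> (t * y) / laplace \<mu> (inverse t)\<bar>
        \<le> (1 / (1/2) powr \<rho> + 1) / c * exp (y / 2)"
      using half nz eventually_gt_at_top[of 0]
    proof eventually_elim
      case (elim t)
      define l where "l = \<bar>laplace \<mu> (inverse t)\<bar>"
      have l: "l > 0" using elim by (simp add: l_def)
      have e1: "\<bar>laplace \<mu> ((1/2) / t)\<bar> \<le> (1 / (1/2) powr \<rho> + 1) * l"
        using elim(1) l by (simp add: abs_divide l_def[symmetric] pos_divide_less_eq)
      show ?case
      proof (intro allI impI)
        fix y :: real assume "y > 0"
        have "\<bar>distr_fun \<mu> (t * y)\<bar> \<le> exp ((1/2) * y) * laplace_abs \<mu> ((1/2) / t)"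
          using abs_distr_fun_le variation_fun_le_laplace_abs[OF elim(4), of "1/2" y] order_trans by fastforce
        also have "\<dots> \<le> exp ((1/2) * y) * ((1 / (1/2) powr \<rho> + 1) * l / c)"
          using elim(2) divide_right_mono[OF e1, of c] c(1) by (intro mult_left_mono) auto
        finally have "\<bar>distr_fun \<mu> (t * y)\<bar> \<le> (1 / (1/2) powr \<rho> + 1) / c * exp (y / 2) * l"
          by (simp add: mult_ac)
        then show "\<bar>distr_fun \<mu> (t * y) / laplace \<mu> (inverse t)\<bar> \<le> (1 / (1/2) powr \<rho> + 1) / c * exp (y / 2)"
          using l by (simp add: abs_divide l_def[symmetric] pos_divide_le_eq)
      qed
    qed
    have hH: "has_bochner_integral lborel (\<lambda>y. indicator {0<..} y * (exp (- s * y) * (y powr \<rho> / Gamma (\<rho> + 1))))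
        (1 / s powr (\<rho> + 1))" if "s > 0" for s
      using has_bochner_integral_divide_zero[OF has_bochner_integral_Gamma[of \<rho> s], of "Gamma (\<rho> + 1)"] that \<rho> Gpos
      by simp
    show "integrable lborel (\<lambda>y. indicator {0<..} y * (exp (- y) * (y powr \<rho> / Gamma (\<rho> + 1))))"
      using integrable.intros[OF hH[OF zero_less_one]] by simp
    show "((\<lambda>t. \<integral>y. indicator {0<..} y * (exp (- (real k + 1) * y) * (distr_fun \<mu> (t * y) / laplace \<mu> (inverse t))) \<partial>lborel)
        \<longlongrightarrow> (\<integral>y. indicator {0<..} y * (exp (- (real k + 1) * y) * (y powr \<rho> / Gamma (\<rho> + 1))) \<partial>lborel)) at_top" for k :: nat
    proof -
      define s where "s = real k + 1"
      have s: "s > 0" by (simp add: s_def)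
      \<comment> \<open>Integration by parts carries the factor \<open>s\<close>, so the moment of
        order \<open>k\<close> is
        \<open>laplace \<mu> (s / t) / (s * laplace \<mu> (inverse t))\<close>.\<close>
      have "((\<lambda>t. 1 / s * (laplace \<mu> (s / t) / laplace \<mu> (inverse t))) \<longlongrightarrow> 1 / s * (1 / s powr \<rho>)) at_top"
        by (intro tendsto_mult tendsto_const lim s)
      also have "1 / s * (1 / s powr \<rho>) = (\<integral>y. indicator {0<..} y * (exp (- s * y) * (y powr \<rho> / Gamma (\<rho> + 1))) \<partial>lborel)"
        using has_bochner_integral_integral_eq[OF hH[OF s]] s by (simp add: powr_add mult.commute)
      finally show ?thesis unfolding s_def[symmetric]
      proof (rule Lim_transform_eventually)
        show "\<forall>\<^sub>F t in at_top. 1 / s * (laplace \<mu> (s / t) / laplace \<mu> (inverse t)) =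
          (\<integral>y. indicator {0<..} y * (exp (- s * y) * (distr_fun \<mu> (t * y) / laplace \<mu> (inverse t))) \<partial>lborel)"
          using eventually_gt_at_top[of 0]
        proof eventually_elim
          case (elim t)
          have "(\<integral>y. indicator {0<..} y * (exp (- s * y) * (distr_fun \<mu> (t * y) / laplace \<mu> (inverse t))) \<partial>lborel) =
              (\<integral>y. indicator {0<..} y * (s * exp (- s * y) * distr_fun \<mu> (t * y)) / (s * laplace \<mu> (inverse t)) \<partial>lborel)"
            using s by (intro Bochner_Integration.integral_cong) (auto simp: field_simps)
          also have "\<dots> = laplace \<mu> (s / t) / (s * laplace \<mu> (inverse t))"
            unfolding integral_divide_zero has_bochner_integral_integral_eq[OF laplace_by_parts[OF s elim]] ..
          finally show ?case by simp
        qed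
      qed
    qed
    show "isCont (\<lambda>y. y powr \<rho> / Gamma (\<rho> + 1)) x"
      using x Gpos by (intro continuous_intros) auto
    show "\<exists>\<delta>>0. \<forall>h\<in>{0<..<\<delta>}. \<forall>\<^sub>F t in at_top.
        \<bar>distr_fun \<mu> (t * (x + h)) / laplace \<mu> (inverse t) - distr_fun \<mu> (t * x) / laplace \<mu> (inverse t)\<bar> < \<epsilon>"
      if \<epsilon>: "\<epsilon> > 0" for \<epsilon>
    proof -
      have "Limsup (at_right 0) (\<lambda>h. Limsup (at_right 0) (\<lambda>\<tau>. ereal \<bar>(distr_fun \<mu> (inverse \<tau> * (x + h))
          - distr_fun \<mu> (inverse \<tau> * x)) / laplace \<mu> \<tau>\<bar>)) < ereal \<epsilon>"
        using B x \<epsilon> by (simp add: distr_increment_condition_def)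
      \<comment> \<open>The inner upper limit is small for each \<open>h\<close> separately, so the
        threshold for \<open>t\<close> depends on \<open>h\<close>;
        \<open>tauberian_pointwise\<close> accepts exactly this form.\<close>
      from Limsup_lessD[OF this] obtain \<delta> where \<delta>: "\<delta> > 0"
        "\<And>h. 0 < h \<Longrightarrow> h < \<delta> \<Longrightarrow> Limsup (at_right 0) (\<lambda>\<tau>. ereal \<bar>(distr_fun \<mu> (inverse \<tau> * (x + h))
          - distr_fun \<mu> (inverse \<tau> * x)) / laplace \<mu> \<tau>\<bar>) < ereal \<epsilon>"
        unfolding eventually_at_right_field by blast
      show ?thesis
      proof (intro exI[of _ \<delta>] conjI ballI \<delta>(1))
        fix h assume "h \<in> {0<..<\<delta>}"
        then have "\<forall>\<^sub>F \<tau> in at_right 0. ereal \<bar>(distr_fun \<mu> (inverse \<tau> * (x + h))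
            - distr_fun \<mu> (inverse \<tau> * x)) / laplace \<mu> \<tau>\<bar> < ereal \<epsilon>"
          by (intro Limsup_lessD \<delta>(2)) auto
        then show "\<forall>\<^sub>F t in at_top. \<bar>distr_fun \<mu> (t * (x + h)) / laplace \<mu> (inverse t) - distr_fun \<mu> (t * x) / laplace \<mu> (inverse t)\<bar> < \<epsilon>"
          by (simp add: eventually_at_right_to_top diff_divide_distrib)
      qed
    qed
  qed (use x in auto)
qed

end

theorem theorem3p2:
  fixes \<mu> :: "real set \<Rightarrow> ereal" and \<rho> :: real
  assumes "\<mu> \<in> laplace_domain" and "\<rho> \<ge> 0"
  shows "(laplace_liminf_condition \<mu> \<and> distr_increment_condition \<mu> \<longrightarrow>
            (laplace_regularly_varying \<mu> \<rho> \<longrightarrow> distr_regularly_varying \<mu> \<rho>)) \<and>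
         (distr_regularly_varying \<mu> \<rho> \<longrightarrow> laplace_regularly_varying \<mu> \<rho>) \<and>
         ((laplace_liminf_condition \<mu> \<and> distr_increment_condition \<mu> \<and>
             laplace_regularly_varying \<mu> \<rho>) \<or> distr_regularly_varying \<mu> \<rho> \<longrightarrow>
          ((\<lambda>t. laplace \<mu> (inverse t) / (distr_fun \<mu> t * Gamma (\<rho> + 1))) \<longlongrightarrow> 1) at_top)"
proof -
  have Gpos: "Gamma (\<rho> + 1) > 0" using assms(2) by (simp add: Gamma_real_pos)
  have part_a: "distr_regularly_varying \<mu> \<rho>"
    if a: "laplace_liminf_condition \<mu>" "distr_increment_condition \<mu>" "laplace_regularly_varying \<mu> \<rho>"
  proof -
    note lim = distr_asymp_of_laplace[OF assms a(3,1,2)]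
    have "\<forall>\<^sub>F t in at_top. distr_fun \<mu> (t * 1) / laplace \<mu> (inverse t) \<noteq> 0"
      by (rule tendsto_imp_eventually_ne[OF lim]) (use Gpos in auto)
    \<comment> \<open>Since division by 0 yields 0, a nonzero quotient forces numerator and
      denominator to be nonzero.\<close>
    then have nz: "\<forall>\<^sub>F t in at_top. distr_fun \<mu> t \<noteq> 0 \<and> laplace \<mu> (inverse t) \<noteq> 0"
      by eventually_elim auto
    have "((\<lambda>t. distr_fun \<mu> (t * x) / distr_fun \<mu> t) \<longlongrightarrow> x powr \<rho>) at_top" if x: "x > 0" for x
    proof -
      \<comment> \<open>Dividing the limit at \<open>x\<close> by the limit at 1 cancels both
        \<open>laplace\<close> and the Gamma factor.\<close>
      have "((\<lambda>t. (distr_fun \<mu> (t * x) / laplace \<mu> (inverse t)) / (distr_fun \<mu> (t * 1) / laplace \<mu> (inverse t)))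
          \<longlongrightarrow> (x powr \<rho> / Gamma (\<rho> + 1)) / (1 powr \<rho> / Gamma (\<rho> + 1))) at_top"
        by (intro tendsto_divide lim x) (use Gpos in auto)
      then have "((\<lambda>t. (distr_fun \<mu> (t * x) / laplace \<mu> (inverse t)) / (distr_fun \<mu> (t * 1) / laplace \<mu> (inverse t)))
          \<longlongrightarrow> x powr \<rho>) at_top" using Gpos by simp
      then show ?thesis
        by (rule Lim_transform_eventually) (use nz in eventually_elim, simp)
    qed
    then show ?thesis unfolding distr_regularly_varying_def
      using nz by (auto elim: eventually_mono)
  qed
  have part_b: "laplace_regularly_varying \<mu> \<rho>" if F: "distr_regularly_varying \<mu> \<rho>"
  proof -
    note lim = laplace_asymp_of_distr[OF assms F]
    have ne: "\<forall>\<^sub>F t in at_top. laplace \<mu> (inverse t) / distr_fun \<mu> t \<noteq> 0"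
      by (rule tendsto_imp_eventually_ne[OF lim]) (use Gpos in auto)
    then have nz: "\<forall>\<^sub>F t in at_top. laplace \<mu> (inverse t) \<noteq> 0 \<and> distr_fun \<mu> t \<noteq> 0"
      by eventually_elim auto
    have "((\<lambda>t. laplace \<mu> (inverse t * s) / laplace \<mu> (inverse t)) \<longlongrightarrow> 1 / s powr \<rho>) at_top" if s: "s > 0" for s
    proof -
      have sub: "filterlim (\<lambda>t. t * (1 / s)) at_top at_top"
        by (rule filterlim_at_top_mult_tendsto_pos[OF tendsto_const _ filterlim_ident]) (use s in simp)
      \<comment> \<open>The ratio of transforms telescopes through \<open>distr_fun\<close> at
        \<open>t / s\<close> and at \<open>t\<close>; the outer factors tend to
        \<open>Gamma (\<rho> + 1)\<close> and its inverse, and the middle one is regular variation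
        at \<open>1 / s\<close>.\<close>
      have "((\<lambda>t. laplace \<mu> (inverse (t * (1 / s))) / distr_fun \<mu> (t * (1 / s)) *
          (distr_fun \<mu> (t * (1 / s)) / distr_fun \<mu> t) / (laplace \<mu> (inverse t) / distr_fun \<mu> t))
          \<longlongrightarrow> Gamma (\<rho> + 1) * (1 / s) powr \<rho> / Gamma (\<rho> + 1)) at_top"
      proof (intro tendsto_divide tendsto_mult lim filterlim_compose[OF lim sub])
        show "((\<lambda>t. distr_fun \<mu> (t * (1 / s)) / distr_fun \<mu> t) \<longlongrightarrow> (1 / s) powr \<rho>) at_top"
          using F s unfolding distr_regularly_varying_def by (metis zero_less_divide_1_iff)
      qed (use Gpos in simp)
      then have "((\<lambda>t. laplace \<mu> (inverse (t * (1 / s))) / distr_fun \<mu> (t * (1 / s)) *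
          (distr_fun \<mu> (t * (1 / s)) / distr_fun \<mu> t) / (laplace \<mu> (inverse t) / distr_fun \<mu> t))
          \<longlongrightarrow> 1 / s powr \<rho>) at_top"
        using Gpos s by (simp add: powr_divide)
      then show ?thesis
      proof (rule Lim_transform_eventually)
        have "\<forall>\<^sub>F t in at_top. distr_fun \<mu> (t * (1 / s)) \<noteq> 0"
          using nz sub unfolding filterlim_iff by (auto elim: eventually_mono)
        then show "\<forall>\<^sub>F t in at_top. laplace \<mu> (inverse (t * (1 / s))) / distr_fun \<mu> (t * (1 / s)) *
          (distr_fun \<mu> (t * (1 / s)) / distr_fun \<mu> t) / (laplace \<mu> (inverse t) / distr_fun \<mu> t) =
          laplace \<mu> (inverse t * s) / laplace \<mu> (inverse t)"
          using nz by eventually_elim (simp add: divide_inverse)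
      qed
    qed
    then show ?thesis
      using nz unfolding laplace_regularly_varying_def eventually_at_right_to_top filterlim_at_right_to_top
      by (auto elim: eventually_mono)
  qed
  have asymp: "((\<lambda>t. laplace \<mu> (inverse t) / (distr_fun \<mu> t * Gamma (\<rho> + 1))) \<longlongrightarrow> 1) at_top"
    if "distr_regularly_varying \<mu> \<rho>"
    using tendsto_divide[OF laplace_asymp_of_distr[OF assms that] tendsto_const[of "Gamma (\<rho> + 1)"]] Gpos
    by simp
  \<comment> \<open>Under the conditions of (a), \<open>part_a\<close> yields (F), so
    \<open>asymp\<close> covers both alternatives.\<close>
  show ?thesis using part_a part_b asymp by blast
qed

end
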